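(* Let $M_{g-1}$ be the quasi-polarised superspecial Dieudonné module at the top of a polarised flag type quotient (PFTQ) of Dieudonné modules of genus $g$ over $W(k)$, and let $e_1,f_1,\dots,e_g,f_g$ be a normal-form basis of $M_{g-1}$ (as defined in the context). (i) If $g$ is odd, then the quasi-polarisation $M_{g-1}\times M_{g-1}\to W(k)[p^{-1}]$ with respect to the basis $\{e_1,f_1,\dots,e_g,f_g\}$ is given by the block diagonal matrix with $g$ identical blocks $$\begin{pmatrix}0&p^{-\frac{g-1}{2}}\\-p^{-\frac{g-1}{2}}&0\end{pmatrix}.$$ (ii) If $g$ is even, then the quasi-polarisation $M_{g-1}\times M_{g-1}\to W(k)[p^{-1}]$ with respect to the basis $\{e_1,f_1,\dots,e_g,f_g\}$ is given by the block diagonal matrix with $g/2$ identical blocks $$\begin{pmatrix}0&0&p^{-\frac g2}&0\\0&0&0&p^{-\frac g2+1}\\-p^{-\frac g2}&0&0&0\\0&-p^{-\frac g2+1}&0&0\end{pmatrix}.$$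
   Context: $k$ is an algebraically closed field of characteristic $p$, $W(k)$ its ring of Witt vectors with Frobenius $\sigma$. A Dieudonné module is a left module over the ring $\mathcal D_k$ generated over $W(k)$ by $F,V$ with $Fw=\sigma(w)F$, $wV=V\sigma(w)$ for $w\in W(k)$, $FV=VF=p$. Here all are free of finite rank over $W(k)$; the genus is half the rank. $A_{1,1}=\mathcal D_k/\mathcal D_k(F-V)$. A Dieudonné module is supersingular (superspecial) if it is the contravariant Dieudonné module of the $p$-divisible group of a supersingular (superspecial) abelian variety. A quasi-polarised Dieudonné module is a Dieudonné module $M$ with a non-degenerate alternating $W(k)$-bilinear form $\langle\cdot,\cdot\rangle:M\times M\to\mathrm{Frac}(W(k))=W(k)[p^{-1}]$ with $\langle Fx,y\rangle=\sigma(\langle x,Vy\rangle)$. The dual module $M^t=\mathrm{Hom}_{W(k)}(M,W(k))$ is identified with $\{y\in M\otimes\mathrm{Frac}(W(k)):\langle M,y\rangle\subseteq W(k)\}$ by sending $b\in M^t$ to the unique $y_b$ with $b(m)=\langle m,y_b\rangle$ for all $m\in M$; in the PFTQ setting $M^t\subseteq M$. The quasi-polarisation on $M^t$ is $\langle a,b\rangle=\langle y_a,y_b\rangle=b(y_a)$. A PFTQ of Dieudonné modules of genus $g$ over $W(k)$ is a filtration $M_{g-1}\supseteq\dots\supseteq M_0$ of quasi-polarised supersingular Dieudonné modules of genus $g$ (forms by restriction) such that (i) $M_{g-1}\cong A_{1,1}^{\oplus g}$ and $M_{g-1}^t=F^{g-1}M_{g-1}$; (ii) $(F,V)M_i\subseteq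 M_{i-1}$ and $\dim_k(M_i/M_{i-1})=i$ for $1\le i\le g-1$; (iii) $F^{i-j}V^jM_i\subseteq M_i^t$ for all $0\le j\le\lfloor i/2\rfloor$. Normal-form basis (such a basis always exists for the top of a PFTQ): a $W(k)$-basis $e_1,f_1,\dots,e_g,f_g$ of $M_{g-1}$ such that, for $g$ odd, $Fe_i=f_i$, $Ve_i=-f_i$, $Ff_i=-pe_i$, $Vf_i=pe_i$ and the quasi-polarisation on $M_{g-1}^t$ in the dual basis is block diagonal with $g$ blocks $\begin{pmatrix}0&p^{(g-1)/2}\\-p^{(g-1)/2}&0\end{pmatrix}$; and, for $g$ even, $Fe_i=Ve_i=f_i$, $Ff_i=Vf_i=pe_i$ and the quasi-polarisation on $M_{g-1}^t$ in the dual basis is block diagonal with $g/2$ blocks $\begin{pmatrix}0&0&p^{g/2}&0\\0&0&0&p^{g/2-1}\\-p^{g/2}&0&0&0\\0&-p^{g/2-1}&0&0\end{pmatrix}$. *)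

theory Defs
  imports "HOL-Library.Poly_Mapping" "HOL-Computational_Algebra.Computational_Algebra" "Jordan_Normal_Form.Matrix"
begin

section \<open>Witt vectors\<close>

subsection \<open>Integer polynomials and ghost components\<close>

type_synonym 'v zpoly = "('v \<Rightarrow>\<^sub>0 nat) \<Rightarrow>\<^sub>0 int"

definition zvar :: "'v \<Rightarrow> 'v zpoly" where
  "zvar v = Poly_Mapping.single (Poly_Mapping.single v 1) 1"

definition monom_eval :: "('v \<Rightarrow> 'a::comm_ring_1) \<Rightarrow> ('v \<Rightarrow>\<^sub>0 nat) \<Rightarrow> 'a" where
  "monom_eval f m = (\<Prod>v\<in>Poly_Mapping.keys m. f v ^ Poly_Mapping.lookup m v)"

definition zpoly_eval :: "('v \<Rightarrow> 'a::comm_ring_1) \<Rightarrow> 'v zpoly \<Rightarrow> 'a" where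
  "zpoly_eval f P =
     (\<Sum>m\<in>Poly_Mapping.keys P. of_int (Poly_Mapping.lookup P m) * monom_eval f m)"

text \<open>The ghost components \<open>w\<^sub>n(z) = \<Sum>\<^sub>i\<^sub>\<le>\<^sub>n p\<^sup>i z\<^sub>i\<^bsup>p^(n-i)\<^esup>\<close>.\<close>

definition ghost :: "nat \<Rightarrow> nat \<Rightarrow> (nat \<Rightarrow> 'a::comm_semiring_1) \<Rightarrow> 'a" where
  "ghost p n z = (\<Sum>i\<le>n. of_nat p ^ i * z i ^ (p ^ (n - i)))"

text \<open>The sequence with prescribed ghost components \<open>x\<close>, solved for recursively; the quotient
  by \<open>p\<^sup>n\<close> is exact for all sequences \<open>x\<close> used below.\<close>

fun ghost_solve :: "nat \<Rightarrow> (nat \<Rightarrow> 'a::comm_ring_1) \<Rightarrow> nat \<Rightarrow> 'a" where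
  "ghost_solve p x n =
     (THE q. of_nat p ^ n * q = x n - (\<Sum>i<n. of_nat p ^ i * ghost_solve p x i ^ (p ^ (n - i))))"

declare ghost_solve.simps [simp del]

subsection \<open>Evaluation is a ring homomorphism\<close>

lemma monom_eval_superset:
  assumes "finite S" "Poly_Mapping.keys m \<subseteq> S"
  shows "monom_eval f m = (\<Prod>v\<in>S. f v ^ Poly_Mapping.lookup m v)"
  unfolding monom_eval_def
  by (rule prod.mono_neutral_left) (use assms in \<open>auto simp: in_keys_iff\<close>)

lemma monom_eval_0 [simp]: "monom_eval f 0 = 1"
  by (simp add: monom_eval_def)

lemma monom_eval_add: "monom_eval f (m + m') = monom_eval f m * monom_eval f m'"
proof -
  let ?S = "Poly_Mapping.keys m \<union> Poly_Mapping.keys m'"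
  have "Poly_Mapping.keys (m + m') \<subseteq> ?S" by (rule Poly_Mapping.keys_add)
  then show ?thesis
    by (simp add: monom_eval_superset[of ?S] lookup_add power_add prod.distrib)
qed

lemma zpoly_eval_superset:
  assumes "finite S" "Poly_Mapping.keys P \<subseteq> S"
  shows "zpoly_eval f P = (\<Sum>m\<in>S. of_int (Poly_Mapping.lookup P m) * monom_eval f m)"
  unfolding zpoly_eval_def
  by (rule sum.mono_neutral_left) (use assms in \<open>auto simp: in_keys_iff\<close>)

lemma zpoly_eval_add: "zpoly_eval f (P + Q) = zpoly_eval f P + zpoly_eval f Q"
proof -
  let ?S = "Poly_Mapping.keys P \<union> Poly_Mapping.keys Q"
  have "Poly_Mapping.keys (P + Q) \<subseteq> ?S" by (rule Poly_Mapping.keys_add)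
  then show ?thesis
    by (simp add: zpoly_eval_superset[of ?S] lookup_add sum.distrib algebra_simps)
qed

lemma zpoly_eval_0 [simp]: "zpoly_eval f 0 = 0"
  by (simp add: zpoly_eval_def)

lemma zpoly_eval_sum: "zpoly_eval f (\<Sum>i\<in>I. P i) = (\<Sum>i\<in>I. zpoly_eval f (P i))"
  by (induction I rule: infinite_finite_induct) (simp_all add: zpoly_eval_add)

lemma zpoly_eval_single: "zpoly_eval f (Poly_Mapping.single m c) = of_int c * monom_eval f m"
  by (simp add: zpoly_eval_def)

lemma zpoly_eval_var [simp]: "zpoly_eval f (zvar v) = f v"
  by (simp add: zvar_def zpoly_eval_single monom_eval_def)

lemma zpoly_as_sum:
  "P = (\<Sum>m\<in>Poly_Mapping.keys P. Poly_Mapping.single m (Poly_Mapping.lookup P m))"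
  by (rule poly_mapping_eqI) (simp add: lookup_sum lookup_single when_def in_keys_iff)

lemma zpoly_eval_mult: "zpoly_eval f (P * Q) = zpoly_eval f P * zpoly_eval f Q"
proof -
  let ?s = "\<lambda>P m. Poly_Mapping.single m (Poly_Mapping.lookup P m)"
  have "zpoly_eval f (P * Q) =
    zpoly_eval f ((\<Sum>m\<in>Poly_Mapping.keys P. ?s P m) * (\<Sum>m\<in>Poly_Mapping.keys Q. ?s Q m))"
    by (simp flip: zpoly_as_sum)
  also have "\<dots> = (\<Sum>m\<in>Poly_Mapping.keys P. \<Sum>m'\<in>Poly_Mapping.keys Q.
      zpoly_eval f (?s P m) * zpoly_eval f (?s Q m'))"
    by (simp add: sum_product zpoly_eval_sum mult_single zpoly_eval_single monom_eval_add mult_ac)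
  also have "\<dots> = zpoly_eval f P * zpoly_eval f Q"
    unfolding zpoly_eval_single unfolding zpoly_eval_def sum_product ..
  finally show ?thesis .
qed

lemma zpoly_eval_1 [simp]: "zpoly_eval f 1 = 1"
  using zpoly_eval_single[of f 0 1] by simp

lemma zpoly_eval_uminus: "zpoly_eval f (- P) = - zpoly_eval f P"
  using zpoly_eval_add[of f P "- P"] by (simp add: eq_neg_iff_add_eq_0 add.commute)

text \<open>Unital ring homomorphisms between arbitrary commutative rings.\<close>

definition ring_hom1 :: "('a::comm_ring_1 \<Rightarrow> 'b::comm_ring_1) \<Rightarrow> bool" where
  "ring_hom1 h \<longleftrightarrow> (\<forall>x y. h (x + y) = h x + h y) \<and> (\<forall>x y. h (x * y) = h x * h y) \<and> h 1 = 1"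

lemma ring_hom1_eval: "ring_hom1 (zpoly_eval f)"
  by (simp add: ring_hom1_def zpoly_eval_add zpoly_eval_mult)

context
  fixes h :: "'a::comm_ring_1 \<Rightarrow> 'b::comm_ring_1"
  assumes h: "ring_hom1 h"
begin

lemma hom_add: "h (x + y) = h x + h y" and hom_mult: "h (x * y) = h x * h y" and hom_1: "h 1 = 1"
  using h by (auto simp: ring_hom1_def)

lemma hom_0: "h 0 = 0"
  using hom_add[of 0 0] by simp

lemma hom_uminus: "h (- x) = - h x"
  using hom_add[of x "- x"] by (simp add: hom_0 eq_neg_iff_add_eq_0 add.commute)

lemma hom_diff: "h (x - y) = h x - h y"
  using hom_add[of x "- y"] by (simp add: hom_uminus)

lemma hom_sum: "h (\<Sum>i\<in>I. g i) = (\<Sum>i\<in>I. h (g i))"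
  by (induction I rule: infinite_finite_induct) (simp_all add: hom_0 hom_add)

lemma hom_prod: "h (\<Prod>i\<in>I. g i) = (\<Prod>i\<in>I. h (g i))"
  by (induction I rule: infinite_finite_induct) (simp_all add: hom_1 hom_mult)

lemma hom_power: "h (x ^ n) = h x ^ n"
  by (induction n) (simp_all add: hom_1 hom_mult)

lemma hom_of_nat: "h (of_nat n) = of_nat n"
  by (induction n) (simp_all add: hom_0 hom_1 hom_add)

lemma hom_of_int: "h (of_int n) = of_int n"
  by (cases n rule: int_diff_cases) (simp add: hom_diff hom_of_nat)

lemma hom_eval: "h (zpoly_eval f P) = zpoly_eval (\<lambda>v. h (f v)) P"
  by (simp add: zpoly_eval_def monom_eval_def hom_sum hom_mult hom_of_int hom_prod hom_power)

lemma hom_ghost: "h (ghost p n z) = ghost p n (\<lambda>i. h (z i))"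
  by (simp add: ghost_def hom_sum hom_mult hom_power hom_of_nat)

end

subsection \<open>Integrality of ghost components\<close>

lemma lookup_of_nat_mult:
  fixes P :: "'v zpoly"
  shows "Poly_Mapping.lookup (of_nat c * P) m = of_nat c * Poly_Mapping.lookup P m"
  by (induction c) (simp_all add: distrib_right lookup_add)

lemma zpoly_cancel:
  fixes P Q :: "'v zpoly"
  assumes "c > 0" "of_nat c * P = of_nat c * Q"
  shows "P = Q"
proof (rule poly_mapping_eqI)
  fix m
  show "Poly_Mapping.lookup P m = Poly_Mapping.lookup Q m"
    using arg_cong[OF assms(2), of "\<lambda>R. Poly_Mapping.lookup R m"] assms(1)
    by (simp add: lookup_of_nat_mult)
qed

lemma zpoly_cancel_power:
  fixes P Q :: "'v zpoly"
  assumes "p > 0" "of_nat p ^ n * P = of_nat p ^ n * Q"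
  shows "P = Q"
  by (rule zpoly_cancel[of "p ^ n"]) (use assms in auto)

lemma binomial_dvd_aux:
  fixes a b :: "'a::comm_ring_1"
  assumes "prime p"
  shows "of_nat p dvd (a + b) ^ p - (a ^ p + b ^ p)"
proof -
  have p: "p > 0" using assms prime_gt_0_nat by blast
  have *: "{..p} = insert 0 (insert p {0<..<p})" using p by auto
  have "(a + b) ^ p - (a ^ p + b ^ p) = (\<Sum>k\<in>{0<..<p}. of_nat (p choose k) * a ^ k * b ^ (p - k))"
    unfolding binomial_ring * using p by (subst sum.insert; simp)+
  also have "of_nat p dvd \<dots>"
  proof (rule dvd_sum)
    fix k assume "k \<in> {0<..<p}"
    then have "p dvd (p choose k)"
      using assms by (intro dvd_choose_prime) auto
    then have "(of_nat p :: 'a) dvd of_nat (p choose k)"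
      by (auto elim!: dvdE)
    then show "(of_nat p :: 'a) dvd of_nat (p choose k) * a ^ k * b ^ (p - k)"
      by simp
  qed
  finally show ?thesis .
qed

lemma dvd_power_lift:
  fixes a b :: "'a::comm_ring_1"
  assumes p: "prime p" and d: "of_nat p dvd a - b"
  shows "of_nat p ^ Suc n dvd a ^ (p ^ n) - b ^ (p ^ n)"
proof (induction n)
  case 0
  then show ?case using d by simp
next
  case (Suc n)
  define x where "x = a ^ (p ^ n)"
  define y where "y = b ^ (p ^ n)"
  have xy: "of_nat p ^ Suc n dvd x - y" using Suc by (simp add: x_def y_def)
  have pd: "of_nat p dvd x - y"
    using dvd_trans[OF _ xy, of "of_nat p"] by simp
  let ?S = "\<Sum>i<p. y ^ (p - Suc i) * x ^ i"
  have S: "?S = (\<Sum>i<p. y ^ (p - Suc i) * (x ^ i - y ^ i)) + of_nat p * y ^ (p - 1)"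
  proof -
    have "(\<Sum>i<p. y ^ (p - Suc i) * y ^ i) = (\<Sum>i<p. y ^ (p - 1))"
      by (rule sum.cong) (auto simp flip: power_add)
    then show ?thesis by (simp add: right_diff_distrib sum_subtractf)
  qed
  have xyi: "x - y dvd x ^ i - y ^ i" for i
    by (subst power_diff_sumr2) (rule dvd_triv_left)
  have "of_nat p dvd ?S" unfolding S
  proof (rule dvd_add[OF dvd_sum[OF dvd_mult]])
    show "of_nat p dvd x ^ i - y ^ i" for i
      using pd xyi by (rule dvd_trans)
  qed (rule dvd_triv_left)
  then have "of_nat p ^ Suc n * of_nat p dvd (x - y) * ?S"
    by (rule mult_dvd_mono[OF xy])
  then have "of_nat p ^ Suc (Suc n) dvd (x - y) * ?S" by (simp add: mult_ac)
  also have "(x - y) * (\<Sum>i<p. y ^ (p - Suc i) * x ^ i) = x ^ p - y ^ p"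
    by (rule power_diff_sumr2[symmetric])
  also have "\<dots> = a ^ (p ^ Suc n) - b ^ (p ^ Suc n)"
    by (simp add: x_def y_def mult.commute flip: power_mult)
  finally show ?case .
qed

lemma fermat_int:
  fixes c :: int
  assumes p: "prime p"
  shows "int p dvd c ^ p - c"
proof -
  have nat: "int p dvd int n ^ p - int n" for n
  proof (induction n)
    case 0
    then show ?case using prime_gt_0_nat[OF p] by (simp add: power_0_left)
  next
    case (Suc n)
    have "int p dvd (int n + 1) ^ p - (int n ^ p + 1 ^ p)"
      using binomial_dvd_aux[OF p, of "int n" 1] by simp
    from dvd_add[OF this Suc.IH] show ?case by (simp add: add.commute diff_diff_eq)
  qed
  define n where "n = nat (c mod int p)"
  have n: "int n = c mod int p" using prime_gt_0_nat[OF p] by (simp add: n_def)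
  have "int p dvd c - int n" unfolding n by (simp add: mod_eq_dvd_iff)
  moreover have "c - int n dvd c ^ p - int n ^ p"
    by (subst power_diff_sumr2) (rule dvd_triv_left)
  ultimately have "int p dvd c ^ p - int n ^ p" "int p dvd c - int n" using dvd_trans by blast+
  then have "int p dvd (c ^ p - int n ^ p) + (int n ^ p - int n) - (c - int n)"
    using nat[of n] by (meson dvd_diff dvd_add)
  then show ?thesis by simp
qed

definition zfrob :: "nat \<Rightarrow> 'v zpoly \<Rightarrow> 'v zpoly" where
  "zfrob p = zpoly_eval (\<lambda>v. zvar v ^ p)"

lemma zfrob_hom: "ring_hom1 (zfrob p)"
  unfolding zfrob_def by (rule ring_hom1_eval)

lemma monom_eval_var: "monom_eval zvar m = Poly_Mapping.single m 1"
proof -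
  have pw: "zvar v ^ k = Poly_Mapping.single (Poly_Mapping.single v k) 1" for v :: 'a and k
    by (induction k) (simp_all add: zvar_def mult_single flip: single_add)
  have "(\<Prod>v\<in>S. Poly_Mapping.single (g v) (1::int)) = Poly_Mapping.single (\<Sum>v\<in>S. g v) 1"
    for S and g :: "'a \<Rightarrow> ('a \<Rightarrow>\<^sub>0 nat)"
    by (induction S rule: infinite_finite_induct) (simp_all add: mult_single)
  moreover have "m = (\<Sum>v\<in>Poly_Mapping.keys m. Poly_Mapping.single v (Poly_Mapping.lookup m v))"
    by (rule poly_mapping_eqI) (simp add: lookup_sum lookup_single when_def in_keys_iff)
  ultimately show ?thesis
    unfolding monom_eval_def pw by simp
qed

lemma of_int_dvd_lift:
  assumes "int p dvd c" shows "(of_nat p :: 'a::comm_ring_1) dvd of_int c"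
  using assms by (auto elim!: dvdE)

lemma zfrob_cong:
  fixes P :: "'v zpoly"
  assumes p: "prime p"
  shows "of_nat p dvd zfrob p P - P ^ p"
proof -
  have single: "of_nat p dvd zfrob p (Poly_Mapping.single m c) - (Poly_Mapping.single m c) ^ p"
    for m :: "'v \<Rightarrow>\<^sub>0 nat" and c
  proof -
    have s: "Poly_Mapping.single m c = of_int c * monom_eval zvar m"
      by (simp add: monom_eval_var mult_single flip: single_of_int)
    have "zfrob p (Poly_Mapping.single m c) = of_int c * monom_eval zvar m ^ p"
      by (simp add: zfrob_def zpoly_eval_single monom_eval_def prod_power_distrib mult.commute
          flip: power_mult)
    then have "zfrob p (Poly_Mapping.single m c) - (Poly_Mapping.single m c) ^ p =
        of_int (- (c ^ p - c)) * monom_eval zvar m ^ p"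
      unfolding s by (simp add: power_mult_distrib algebra_simps)
    moreover have "int p dvd - (c ^ p - c)" using fermat_int[OF p] by (subst dvd_minus_iff)
    ultimately show ?thesis
      by (simp only: dvd_mult2 of_int_dvd_lift)
  qed
  have "of_nat p dvd zfrob p (\<Sum>m\<in>S. Poly_Mapping.single m (c m)) - (\<Sum>m\<in>S. Poly_Mapping.single m (c m)) ^ p"
    for S and c :: "('v \<Rightarrow>\<^sub>0 nat) \<Rightarrow> int"
  proof (induction S rule: infinite_finite_induct)
    case (insert m S)
    let ?a = "Poly_Mapping.single m (c m)" and ?b = "\<Sum>m\<in>S. Poly_Mapping.single m (c m)"
    have "of_nat p dvd (zfrob p ?a - ?a ^ p) + (zfrob p ?b - ?b ^ p) - ((?a + ?b) ^ p - (?a ^ p + ?b ^ p))"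
      by (intro dvd_diff dvd_add single insert.IH binomial_dvd_aux p)
    then show ?case using insert.hyps by (simp add: hom_add[OF zfrob_hom] algebra_simps)
  qed (use prime_gt_0_nat[OF p] in \<open>simp_all add: hom_0[OF zfrob_hom] power_0_left\<close>)
  from this[of "Poly_Mapping.lookup P" "Poly_Mapping.keys P"] show ?thesis
    by (simp flip: zpoly_as_sum)
qed

lemma ghost_Suc_cong:
  fixes z :: "nat \<Rightarrow> 'v zpoly"
  assumes p: "prime p"
  shows "of_nat p ^ Suc n dvd (\<Sum>i\<le>n. of_nat p ^ i * z i ^ (p ^ (Suc n - i))) - zfrob p (ghost p n z)"
proof -
  have "(\<Sum>i\<le>n. of_nat p ^ i * z i ^ (p ^ (Suc n - i))) - zfrob p (ghost p n z) =
      (\<Sum>i\<le>n. of_nat p ^ i * ((z i ^ p) ^ (p ^ (n - i)) - zfrob p (z i) ^ (p ^ (n - i))))"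
    unfolding hom_ghost[OF zfrob_hom]
    by (simp add: ghost_def right_diff_distrib sum_subtractf
        Suc_diff_le flip: power_mult)
  also have "of_nat p ^ Suc n dvd \<dots>"
  proof (rule dvd_sum)
    fix i assume i: "i \<in> {..n}"
    have "of_nat p dvd z i ^ p - zfrob p (z i)"
      using zfrob_cong[OF p, of "z i"] by (metis dvd_minus_iff minus_diff_eq)
    note lift = dvd_power_lift[OF p this, of "n - i"]
    have e: "of_nat p ^ Suc n = of_nat p ^ i * (of_nat p :: 'v zpoly) ^ Suc (n - i)"
    proof -
      have "Suc n = i + Suc (n - i)" using i by simp
      then show ?thesis by (metis power_add)
    qed
    have "of_nat p ^ i * of_nat p ^ Suc (n - i) dvd
        of_nat p ^ i * ((z i ^ p) ^ (p ^ (n - i)) - zfrob p (z i) ^ (p ^ (n - i)))"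
      by (rule mult_dvd_mono[OF dvd_refl lift])
    then show "of_nat p ^ Suc n dvd of_nat p ^ i * ((z i ^ p) ^ (p ^ (n - i)) - zfrob p (z i) ^ (p ^ (n - i)))"
      unfolding e .
  qed
  finally show ?thesis .
qed

definition dwork :: "nat \<Rightarrow> (nat \<Rightarrow> 'v zpoly) \<Rightarrow> bool" where
  "dwork p x \<longleftrightarrow> (\<forall>n. of_nat p ^ Suc n dvd x (Suc n) - zfrob p (x n))"

lemma ghost_Suc: "ghost p (Suc n) z =
    of_nat p ^ Suc n * z (Suc n) + (\<Sum>i\<le>n. of_nat p ^ i * z i ^ (p ^ (Suc n - i)))"
  by (simp add: ghost_def add.commute)

lemma dwork_ghost:
  assumes "prime p" shows "dwork p (\<lambda>n. ghost p n z)"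
  unfolding dwork_def ghost_Suc
  using dvd_add[OF dvd_triv_left ghost_Suc_cong[OF assms, of _ z]]
  by (simp add: add_diff_eq)

lemma dwork_add:
  assumes "dwork p x" "dwork p y" shows "dwork p (\<lambda>n. x n + y n)"
  unfolding dwork_def hom_add[OF zfrob_hom] add_diff_add
  using assms unfolding dwork_def by (intro allI dvd_add) blast+

lemma dwork_uminus:
  assumes "dwork p x" shows "dwork p (\<lambda>n. - x n)"
  unfolding dwork_def hom_uminus[OF zfrob_hom] minus_diff_minus dvd_minus_iff
  using assms unfolding dwork_def .

lemma dwork_mult:
  assumes "dwork p x" "dwork p y" shows "dwork p (\<lambda>n. x n * y n)"
  unfolding dwork_def
proof
  fix n
  have "x (Suc n) * y (Suc n) - zfrob p (x n * y n) =
      x (Suc n) * (y (Suc n) - zfrob p (y n)) + (x (Suc n) - zfrob p (x n)) * zfrob p (y n)"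
    by (simp add: hom_mult[OF zfrob_hom] algebra_simps)
  then show "of_nat p ^ Suc n dvd x (Suc n) * y (Suc n) - zfrob p (x n * y n)"
    using assms unfolding dwork_def by (simp only: dvd_add dvd_mult dvd_mult2)
qed

lemma ghost_ghost_solve:
  fixes x :: "nat \<Rightarrow> 'v zpoly"
  assumes p: "prime p" and x: "dwork p x"
  shows "ghost p n (ghost_solve p x) = x n"
proof -
  have p0: "p > 0" using prime_gt_0_nat[OF p] .
  have the: "of_nat p ^ n * ghost_solve p x n =
      x n - (\<Sum>i<n. of_nat p ^ i * ghost_solve p x i ^ (p ^ (n - i)))"
    if "of_nat p ^ n dvd x n - (\<Sum>i<n. of_nat p ^ i * ghost_solve p x i ^ (p ^ (n - i)))" for n
  proof -
    from that obtain q where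
      q: "x n - (\<Sum>i<n. of_nat p ^ i * ghost_solve p x i ^ (p ^ (n - i))) = of_nat p ^ n * q"
      by (rule dvdE)
    let ?P = "\<lambda>q. of_nat p ^ n * q =
      x n - (\<Sum>i<n. of_nat p ^ i * ghost_solve p x i ^ (p ^ (n - i)))"
    have "?P (THE q. ?P q)"
    proof (rule theI[of ?P q], rule q[symmetric])
      fix r
      assume "of_nat p ^ n * r = x n - (\<Sum>i<n. of_nat p ^ i * ghost_solve p x i ^ (p ^ (n - i)))"
      then have "of_nat p ^ n * r = of_nat p ^ n * q" by (rule trans[OF _ q])
      then show "r = q" by (rule zpoly_cancel_power[OF p0])
    qed
    moreover have "ghost_solve p x n = (THE q. ?P q)" by (rule ghost_solve.simps)
    ultimately show ?thesis by (simp only:)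
  qed
  show ?thesis
  proof (induction n)
    case 0
    show ?case using the[of 0] by (simp add: ghost_def)
  next
    case (Suc n)
    let ?z = "ghost_solve p x"
    have "of_nat p ^ Suc n dvd (x (Suc n) - zfrob p (x n)) -
       ((\<Sum>i\<le>n. of_nat p ^ i * ?z i ^ (p ^ (Suc n - i))) - zfrob p (ghost p n ?z))"
      using x[unfolded dwork_def, rule_format, of n] ghost_Suc_cong[OF p, of n ?z]
      by (rule dvd_diff)
    then have "of_nat p ^ Suc n dvd x (Suc n) - (\<Sum>i<Suc n. of_nat p ^ i * ?z i ^ (p ^ (Suc n - i)))"
      by (simp only: Suc.IH lessThan_Suc_atMost diff_diff_eq2 diff_add_cancel)
    from the[OF this] show ?case
      unfolding ghost_Suc lessThan_Suc_atMost by simp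
  qed
qed

lemma ghost_inj:
  fixes z z' :: "nat \<Rightarrow> 'v zpoly"
  assumes p: "p > 0" and eq: "\<And>n. ghost p n z = ghost p n z'"
  shows "z = z'"
proof
  fix n show "z n = z' n"
  proof (induction n rule: less_induct)
    case (less n)
    have g: "ghost p n y = of_nat p ^ n * y n + (\<Sum>i<n. of_nat p ^ i * y i ^ (p ^ (n - i)))"
      for y :: "nat \<Rightarrow> 'v zpoly"
      by (simp add: ghost_def flip: lessThan_Suc_atMost)
    have "of_nat p ^ n * z n = of_nat p ^ n * z' n"
      using eq[of n] less unfolding g by simp
    then show ?case using p zpoly_cancel_power by blast
  qed
qed


subsection \<open>Witt polynomials\<close>

text \<open>\<open>witt_add_poly p n\<close> is the usual integer polynomial \<open>S\<^sub>n\<close> in the variables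
  \<open>X\<^sub>0, X\<^sub>1, \<dots>\<close> (\<open>Inl i\<close>) and \<open>Y\<^sub>0, Y\<^sub>1, \<dots>\<close> (\<open>Inr i\<close>) with \<open>w\<^sub>n(S) = w\<^sub>n(X) + w\<^sub>n(Y)\<close>;
  similarly for products and negation.\<close>

definition witt_add_poly :: "nat \<Rightarrow> nat \<Rightarrow> (nat + nat) zpoly" where
  "witt_add_poly p = ghost_solve p
     (\<lambda>n. ghost p n (\<lambda>i. zvar (Inl i)) + ghost p n (\<lambda>i. zvar (Inr i)))"

definition witt_mult_poly :: "nat \<Rightarrow> nat \<Rightarrow> (nat + nat) zpoly" where
  "witt_mult_poly p = ghost_solve p
     (\<lambda>n. ghost p n (\<lambda>i. zvar (Inl i)) * ghost p n (\<lambda>i. zvar (Inr i)))"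

definition witt_uminus_poly :: "nat \<Rightarrow> nat \<Rightarrow> nat zpoly" where
  "witt_uminus_poly p = ghost_solve p (\<lambda>n. - ghost p n zvar)"

definition wadd :: "nat \<Rightarrow> (nat \<Rightarrow> 'a) \<Rightarrow> (nat \<Rightarrow> 'a) \<Rightarrow> nat \<Rightarrow> 'a::comm_ring_1" where
  "wadd p a b n = zpoly_eval (case_sum a b) (witt_add_poly p n)"

definition wmult :: "nat \<Rightarrow> (nat \<Rightarrow> 'a) \<Rightarrow> (nat \<Rightarrow> 'a) \<Rightarrow> nat \<Rightarrow> 'a::comm_ring_1" where
  "wmult p a b n = zpoly_eval (case_sum a b) (witt_mult_poly p n)"

definition wneg :: "nat \<Rightarrow> (nat \<Rightarrow> 'a) \<Rightarrow> nat \<Rightarrow> 'a::comm_ring_1" where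
  "wneg p a n = zpoly_eval a (witt_uminus_poly p n)"

lemma ghost_zero: "p > 0 \<Longrightarrow> ghost p n (\<lambda>_. 0) = 0"
  by (simp add: ghost_def power_0_left)

lemma ghost_one:
  assumes "p > 0" shows "ghost p n (\<lambda>i. if i = 0 then 1 else 0) = (1 :: 'a::comm_semiring_1)"
proof -
  have "(\<Sum>i\<le>n. (of_nat p :: 'a) ^ i * (if i = 0 then 1 else 0) ^ (p ^ (n - i))) =
     (\<Sum>i\<le>n. if i = 0 then 1 else 0)"
    by (rule sum.cong) (use assms in \<open>auto simp: power_0_left\<close>)
  then show ?thesis by (simp add: ghost_def)
qed

lemma ghost_wadd:
  assumes "prime p" shows "ghost p n (wadd p a b) = ghost p n a + ghost p n b"
proof -
  let ?h = "zpoly_eval (case_sum a b)"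
  have "ghost p n (wadd p a b) = ?h (ghost p n (witt_add_poly p))"
    by (simp add: hom_ghost[OF ring_hom1_eval] wadd_def[abs_def])
  also have "ghost p n (witt_add_poly p) = ghost p n (\<lambda>i. zvar (Inl i)) + ghost p n (\<lambda>i. zvar (Inr i))"
    unfolding witt_add_poly_def by (rule ghost_ghost_solve) (intro dwork_add dwork_ghost assms)+
  finally show ?thesis by (simp add: zpoly_eval_add hom_ghost[OF ring_hom1_eval])
qed

lemma ghost_wmult:
  assumes "prime p" shows "ghost p n (wmult p a b) = ghost p n a * ghost p n b"
proof -
  let ?h = "zpoly_eval (case_sum a b)"
  have "ghost p n (wmult p a b) = ?h (ghost p n (witt_mult_poly p))"
    by (simp add: hom_ghost[OF ring_hom1_eval] wmult_def[abs_def])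
  also have "ghost p n (witt_mult_poly p) = ghost p n (\<lambda>i. zvar (Inl i)) * ghost p n (\<lambda>i. zvar (Inr i))"
    unfolding witt_mult_poly_def by (rule ghost_ghost_solve) (intro dwork_mult dwork_ghost assms)+
  finally show ?thesis by (simp add: zpoly_eval_mult hom_ghost[OF ring_hom1_eval])
qed

lemma ghost_wneg:
  assumes "prime p" shows "ghost p n (wneg p a) = - ghost p n a"
proof -
  let ?h = "zpoly_eval a"
  have "ghost p n (wneg p a) = ?h (ghost p n (witt_uminus_poly p))"
    by (simp add: hom_ghost[OF ring_hom1_eval] wneg_def[abs_def])
  also have "ghost p n (witt_uminus_poly p) = - ghost p n zvar"
    unfolding witt_uminus_poly_def by (rule ghost_ghost_solve) (intro dwork_uminus dwork_ghost assms)+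
  finally show ?thesis by (simp add: zpoly_eval_uminus hom_ghost[OF ring_hom1_eval])
qed

lemma hom_wadd: "ring_hom1 h \<Longrightarrow> h (wadd p a b n) = wadd p (\<lambda>i. h (a i)) (\<lambda>i. h (b i)) n"
  unfolding wadd_def by (subst hom_eval) (auto intro!: arg_cong2[of _ _ _ _ zpoly_eval] split: sum.split)

lemma hom_wmult: "ring_hom1 h \<Longrightarrow> h (wmult p a b n) = wmult p (\<lambda>i. h (a i)) (\<lambda>i. h (b i)) n"
  unfolding wmult_def by (subst hom_eval) (auto intro!: arg_cong2[of _ _ _ _ zpoly_eval] split: sum.split)

lemma hom_wneg: "ring_hom1 h \<Longrightarrow> h (wneg p a n) = wneg p (\<lambda>i. h (a i)) n"
  unfolding wneg_def by (subst hom_eval) auto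

text \<open>Every sequence over \<open>'a\<close> lifts to one over the polynomial ring on the elements of \<open>'a\<close>,
  where the ghost map is injective.\<close>

abbreviation wlift :: "(nat \<Rightarrow> 'a) \<Rightarrow> nat \<Rightarrow> 'a zpoly" where
  "wlift a \<equiv> \<lambda>i. zvar (a i)"

abbreviation wred :: "'a zpoly \<Rightarrow> 'a::comm_ring_1" where
  "wred \<equiv> zpoly_eval (\<lambda>x. x)"

lemma wred_wadd: "wadd p (\<lambda>i. wred (a i)) (\<lambda>i. wred (b i)) = (\<lambda>i. wred (wadd p a b i))"
  by (simp add: fun_eq_iff hom_wadd[OF ring_hom1_eval])

lemma wred_wmult: "wmult p (\<lambda>i. wred (a i)) (\<lambda>i. wred (b i)) = (\<lambda>i. wred (wmult p a b i))"
  by (simp add: fun_eq_iff hom_wmult[OF ring_hom1_eval])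

lemma wred_wneg: "wneg p (\<lambda>i. wred (a i)) = (\<lambda>i. wred (wneg p a i))"
  by (simp add: fun_eq_iff hom_wneg[OF ring_hom1_eval])

lemma wred_zero: "(\<lambda>_. 0) = (\<lambda>i::nat. wred 0)"
  and wred_one: "(\<lambda>i. if i = 0 then 1 else 0) = (\<lambda>i::nat. wred (if i = 0 then 1 else 0))"
  and wred_wlift: "a = (\<lambda>i. wred (wlift a i))"
  by (simp_all add: fun_eq_iff)

lemma wred_eqI:
  assumes "p > 0" "\<And>n. ghost p n a = ghost p n b"
  shows "(\<lambda>i. wred (a i)) = (\<lambda>i. wred (b i))"
  using ghost_inj[of p a b] assms by simp

context
  fixes p :: nat
  assumes p: "prime p"
begin

lemma p_gt_0: "p > 0"
  using p by (rule prime_gt_0_nat)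

lemmas ghost_simps = ghost_wadd[OF p] ghost_wmult[OF p] ghost_wneg[OF p]
  ghost_zero[OF p_gt_0] ghost_one[OF p_gt_0]

lemma wadd_assoc: "wadd p (wadd p a b) c = wadd p a (wadd p b c)"
  by (subst (1 2) wred_wlift[of a], subst (1 2) wred_wlift[of b], subst (1 2) wred_wlift[of c])
     (unfold wred_wadd, rule wred_eqI[OF p_gt_0], simp add: ghost_simps add.assoc)

lemma wadd_commute: "wadd p a b = wadd p b a"
  by (subst (1 2) wred_wlift[of a], subst (1 2) wred_wlift[of b])
     (unfold wred_wadd, rule wred_eqI[OF p_gt_0], simp add: ghost_simps add.commute)

lemma wadd_zero: "wadd p (\<lambda>_. 0) a = a"
  by (subst (1 2) wred_wlift[of a])
     (unfold wred_zero wred_wadd, rule wred_eqI[OF p_gt_0], simp add: ghost_simps)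

lemma wadd_wneg: "wadd p (wneg p a) a = (\<lambda>_. 0)"
  by (subst (1 2) wred_wlift[of a])
     (unfold wred_zero wred_wadd wred_wneg, rule wred_eqI[OF p_gt_0], simp add: ghost_simps)

lemma wmult_assoc: "wmult p (wmult p a b) c = wmult p a (wmult p b c)"
  by (subst (1 2) wred_wlift[of a], subst (1 2) wred_wlift[of b], subst (1 2) wred_wlift[of c])
     (unfold wred_wmult, rule wred_eqI[OF p_gt_0], simp add: ghost_simps mult.assoc)

lemma wmult_commute: "wmult p a b = wmult p b a"
  by (subst (1 2) wred_wlift[of a], subst (1 2) wred_wlift[of b])
     (unfold wred_wmult, rule wred_eqI[OF p_gt_0], simp add: ghost_simps mult.commute)

lemma wmult_one: "wmult p (\<lambda>i. if i = 0 then 1 else 0) a = a"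
  by (subst (1 2) wred_wlift[of a])
     (subst wred_one, unfold wred_wmult, rule wred_eqI[OF p_gt_0], simp add: ghost_simps)

lemma wmult_wadd: "wmult p (wadd p a b) c = wadd p (wmult p a c) (wmult p b c)"
  by (subst (1 2) wred_wlift[of a], subst (1 2) wred_wlift[of b], subst (1 2 3) wred_wlift[of c])
     (unfold wred_wmult wred_wadd, rule wred_eqI[OF p_gt_0], simp add: ghost_simps algebra_simps)

end

subsection \<open>The ring of Witt vectors\<close>

text \<open>\<open>'k witt\<close> is the ring of \<open>p\<close>-typical Witt vectors of \<open>'k\<close> for \<open>p = CHAR('k)\<close>.\<close>

typedef 'k witt = "UNIV :: (nat \<Rightarrow> 'k) set"
  morphisms witt_nth Abs_witt ..

setup_lifting type_definition_witt

instantiation witt :: (comm_ring_prime_char) comm_ring_1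
begin

lift_definition zero_witt :: "'a witt" is "\<lambda>_. 0" .
lift_definition one_witt :: "'a witt" is "\<lambda>n. if n = 0 then 1 else 0" .
lift_definition plus_witt :: "'a witt \<Rightarrow> 'a witt \<Rightarrow> 'a witt" is "wadd CHAR('a)" .
lift_definition times_witt :: "'a witt \<Rightarrow> 'a witt \<Rightarrow> 'a witt" is "wmult CHAR('a)" .
lift_definition uminus_witt :: "'a witt \<Rightarrow> 'a witt" is "wneg CHAR('a)" .
definition minus_witt :: "'a witt \<Rightarrow> 'a witt \<Rightarrow> 'a witt" where "minus_witt a b = a + - b"

instance
proof
  fix a b c :: "'a witt"
  have p: "prime CHAR('a)" by (rule CHAR_prime)
  show "a + b + c = a + (b + c)" by transfer (rule wadd_assoc[OF p])
  show "a + b = b + a" by transfer (rule wadd_commute[OF p])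
  show "0 + a = a" by transfer (rule wadd_zero[OF p])
  show "- a + a = 0" by transfer (rule wadd_wneg[OF p])
  show "a - b = a + - b" by (rule minus_witt_def)
  show "a * b * c = a * (b * c)" by transfer (rule wmult_assoc[OF p])
  show "a * b = b * a" by transfer (rule wmult_commute[OF p])
  show "1 * a = a" by transfer (rule wmult_one[OF p])
  show "(a + b) * c = a * c + b * c" by transfer (rule wmult_wadd[OF p])
  show "(0::'a witt) \<noteq> 1" by transfer (auto simp: fun_eq_iff)
qed

end

lemma leading_wmult_zpoly:
  fixes a b :: "nat \<Rightarrow> 'v zpoly"
  assumes p: "prime p" and a: "\<And>i. i < n \<Longrightarrow> a i = 0" and b: "\<And>i. i < m \<Longrightarrow> b i = 0"
  shows "of_nat p dvd wmult p a b (n + m) - a n ^ (p ^ m) * b m ^ (p ^ n)"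
proof -
  let ?p = "of_nat p :: 'v zpoly"
  let ?c = "wmult p a b"
  have p0: "p > 0" and p1: "p > 1" using prime_gt_0_nat[OF p] prime_gt_1_nat[OF p] by auto
  have g: "ghost p k y = ?p ^ k * y k + (\<Sum>i<k. ?p ^ i * y i ^ (p ^ (k - i)))"
    for y :: "nat \<Rightarrow> 'v zpoly" and k
    by (simp add: ghost_def flip: lessThan_Suc_atMost)
  have lead: "\<exists>r. ghost p (n + k) y = ?p ^ n * (y n ^ (p ^ k) + ?p * r)"
    if "\<And>i. i < n \<Longrightarrow> y i = 0" for y :: "nat \<Rightarrow> 'v zpoly" and n k
  proof -
    have "ghost p (n + k) y = (\<Sum>i\<in>{n..n+k}. ?p ^ i * y i ^ (p ^ (n + k - i)))"
      unfolding ghost_def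
      by (rule sum.mono_neutral_right) (use that p0 in \<open>auto simp: power_0_left not_le\<close>)
    also have "{n..n+k} = insert n {Suc n..n+k}" by auto
    also have "(\<Sum>i\<in>insert n {Suc n..n+k}. ?p ^ i * y i ^ (p ^ (n + k - i))) =
      ?p ^ n * y n ^ (p ^ k) + (\<Sum>i\<in>{Suc n..n+k}. ?p ^ i * y i ^ (p ^ (n + k - i)))"
      by simp
    also have "(\<Sum>i\<in>{Suc n..n+k}. ?p ^ i * y i ^ (p ^ (n + k - i))) =
      (\<Sum>i\<in>{Suc n..n+k}. ?p ^ n * (?p * (?p ^ (i - Suc n) * y i ^ (p ^ (n + k - i)))))"
    proof (rule sum.cong)
      fix i assume "i \<in> {Suc n..n+k}"
      then have "i = n + (1 + (i - Suc n))" by simp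
      then have "?p ^ i = ?p ^ n * (?p * ?p ^ (i - Suc n))"
        by (metis power_add power_one_right)
      then show "?p ^ i * y i ^ (p ^ (n + k - i)) =
        ?p ^ n * (?p * (?p ^ (i - Suc n) * y i ^ (p ^ (n + k - i))))"
        by (simp add: mult_ac)
    qed simp
    also have "\<dots> = ?p ^ n * (?p * (\<Sum>i\<in>{Suc n..n+k}. ?p ^ (i - Suc n) * y i ^ (p ^ (n + k - i))))"
      by (simp only: sum_distrib_left)
    finally show ?thesis by (intro exI) (simp only: distrib_left)
  qed
  have dv: "?p ^ n dvd ghost p k y" if "\<And>i. i < n \<Longrightarrow> y i = 0" for y :: "nat \<Rightarrow> 'v zpoly" and n k
    unfolding ghost_def
  proof (rule dvd_sum)
    fix i
    show "?p ^ n dvd ?p ^ i * y i ^ (p ^ (k - i))"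
    proof (cases "i < n")
      case True
      then show ?thesis using that p0 by (simp add: power_0_left)
    next
      case False
      then show ?thesis by (intro dvd_mult2 le_imp_power_dvd) simp
    qed
  qed
  have tail: "?p ^ Suc k dvd (\<Sum>i<k. ?p ^ i * ?c i ^ (p ^ (k - i)))" if "\<And>i. i < k \<Longrightarrow> ?p dvd ?c i" for k
  proof (rule dvd_sum)
    fix i assume i: "i \<in> {..<k}"
    have "k - i < p ^ (k - i)" using p1 by (simp add: power_gt_expt)
    then have "Suc (k - i) \<le> p ^ (k - i)" by simp
    then have "?p ^ Suc (k - i) dvd ?p ^ (p ^ (k - i))" by (rule le_imp_power_dvd)
    also have "\<dots> dvd ?c i ^ (p ^ (k - i))" using that i by (intro dvd_power_same) auto
    finally have "?p ^ i * ?p ^ Suc (k - i) dvd ?p ^ i * ?c i ^ (p ^ (k - i))"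
      by (rule mult_dvd_mono[OF dvd_refl])
    moreover have "?p ^ i * ?p ^ Suc (k - i) = ?p ^ Suc k"
    proof -
      have "Suc k = i + Suc (k - i)" using i by simp
      then show ?thesis by (metis power_add)
    qed
    ultimately show "?p ^ Suc k dvd ?p ^ i * ?c i ^ (p ^ (k - i))" by (simp only:)
  qed
  have cancel: "?p dvd x" if "?p ^ Suc k dvd ?p ^ k * x" for x :: "'v zpoly" and k
  proof -
    from that obtain r where "?p ^ k * x = ?p ^ Suc k * r" by (rule dvdE)
    then have "?p ^ k * x = ?p ^ k * (?p * r)" by (simp add: mult_ac)
    then have "x = ?p * r" by (rule zpoly_cancel_power[OF p0])
    then show ?thesis by simp
  qed
  have low: "?p dvd ?c k" if "k < n + m" for k
    using that
  proof (induction k rule: less_induct)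
    case (less k)
    have "?p ^ n * ?p ^ m dvd ghost p k a * ghost p k b"
      by (intro mult_dvd_mono dv a b)
    then have "?p ^ (n + m) dvd ghost p k ?c" by (simp add: ghost_wmult[OF p] power_add)
    moreover have "?p ^ Suc k dvd ?p ^ (n + m)" using less.prems by (intro le_imp_power_dvd) simp
    ultimately have "?p ^ Suc k dvd ghost p k ?c" by (rule dvd_trans[rotated])
    moreover have "?p ^ Suc k dvd (\<Sum>i<k. ?p ^ i * ?c i ^ (p ^ (k - i)))"
      using less by (intro tail) auto
    ultimately have "?p ^ Suc k dvd ghost p k ?c - (\<Sum>i<k. ?p ^ i * ?c i ^ (p ^ (k - i)))"
      by (rule dvd_diff)
    then have "?p ^ Suc k dvd ?p ^ k * ?c k" unfolding g by (simp only: add_diff_cancel_right')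
    then show ?case by (rule cancel)
  qed
  obtain r where r: "ghost p (n + m) a = ?p ^ n * (a n ^ (p ^ m) + ?p * r)" using lead[of n a m] a by blast
  obtain s where s: "ghost p (n + m) b = ?p ^ m * (b m ^ (p ^ n) + ?p * s)"
    using lead[of m b n] b by (metis add.commute)
  let ?u = "a n ^ (p ^ m)" and ?v = "b m ^ (p ^ n)"
  have "?p ^ (n + m) * ?c (n + m) + (\<Sum>i<n+m. ?p ^ i * ?c i ^ (p ^ (n + m - i))) =
     ?p ^ (n + m) * ((?u + ?p * r) * (?v + ?p * s))"
    using ghost_wmult[OF p, of "n + m" a b] unfolding r s
    by (subst (asm) g) (simp add: power_add mult_ac)
  then have e: "?p ^ (n + m) * (?c (n + m) - ?u * ?v) =
    ?p ^ Suc (n + m) * (?u * s + r * ?v + ?p * (r * s)) - (\<Sum>i<n+m. ?p ^ i * ?c i ^ (p ^ (n + m - i)))"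
    by (simp add: algebra_simps)
  have "?p ^ Suc (n + m) dvd (\<Sum>i<n+m. ?p ^ i * ?c i ^ (p ^ (n + m - i)))"
    by (rule tail[OF low])
  then have "?p ^ Suc (n + m) dvd ?p ^ (n + m) * (?c (n + m) - ?u * ?v)"
    unfolding e by (rule dvd_diff[OF dvd_triv_left])
  then show ?thesis by (rule cancel)
qed

lemma leading_wmult:
  fixes a b :: "nat \<Rightarrow> 'a::comm_ring_prime_char"
  assumes "\<And>i. i < n \<Longrightarrow> a i = 0" and "\<And>i. i < m \<Longrightarrow> b i = 0"
  shows "wmult CHAR('a) a b (n + m) = a n ^ (CHAR('a) ^ m) * b m ^ (CHAR('a) ^ n)"
proof -
  let ?p = "CHAR('a)"
  have pp: "prime ?p" by (rule CHAR_prime)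
  let ?l = "\<lambda>a i. if a i = 0 then 0 else zvar (a i) :: 'a zpoly"
  have l: "wred (?l a i) = a i" for a :: "nat \<Rightarrow> 'a" and i by simp
  have "of_nat ?p dvd wmult ?p (?l a) (?l b) (n + m) - ?l a n ^ (?p ^ m) * ?l b m ^ (?p ^ n)"
    by (rule leading_wmult_zpoly[OF pp]) (use assms in auto)
  then obtain r where
    "wmult ?p (?l a) (?l b) (n + m) - ?l a n ^ (?p ^ m) * ?l b m ^ (?p ^ n) = of_nat ?p * r"
    by (rule dvdE)
  then have "wred (wmult ?p (?l a) (?l b) (n + m) - ?l a n ^ (?p ^ m) * ?l b m ^ (?p ^ n)) = wred (of_nat ?p * r)"
    by (rule arg_cong)
  then show ?thesis
    by (simp only: hom_diff[OF ring_hom1_eval] hom_mult[OF ring_hom1_eval] hom_power[OF ring_hom1_eval]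
        hom_of_nat[OF ring_hom1_eval] of_nat_CHAR mult_zero_left eq_iff_diff_eq_0[symmetric]
        hom_wmult[OF ring_hom1_eval] l) 
qed

instance witt :: (idom_prime_char) idom
proof
  fix a b :: "'a witt"
  assume "a \<noteq> 0" "b \<noteq> 0"
  then show "a * b \<noteq> 0"
  proof transfer
    fix a b :: "nat \<Rightarrow> 'a"
    assume "a \<noteq> (\<lambda>_. 0)" "b \<noteq> (\<lambda>_. 0)"
    then obtain i j where ij: "a i \<noteq> 0" "b j \<noteq> 0" by (auto simp: fun_eq_iff)
    define n where "n = (LEAST i. a i \<noteq> 0)"
    define m where "m = (LEAST i. b i \<noteq> 0)"
    have "a n \<noteq> 0" unfolding n_def using ij(1) by (rule LeastI)
    moreover have "b m \<noteq> 0" unfolding m_def using ij(2) by (rule LeastI)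
    moreover have "a i = 0" if "i < n" for i using that not_less_Least unfolding n_def by blast
    moreover have "b i = 0" if "i < m" for i using that not_less_Least unfolding m_def by blast
    ultimately have "wmult CHAR('a) a b (n + m) \<noteq> 0" by (subst leading_wmult) auto
    then show "wmult CHAR('a) a b \<noteq> (\<lambda>_. 0)" by auto
  qed
qed

text \<open>\<open>p\<close> is the Witt vector \<open>(0, 1, \<dots>)\<close>; in particular it is nonzero.\<close>

lemma witt_nth_CHAR:
  "witt_nth (of_nat CHAR('k) :: 'k::comm_ring_prime_char witt) 0 = 0"
  "witt_nth (of_nat CHAR('k) :: 'k::comm_ring_prime_char witt) 1 = 1"
proof -
  let ?p = "CHAR('k)"
  have p: "prime ?p" by (rule CHAR_prime)
  have p0: "?p > 0" using prime_gt_0_nat[OF p] .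
  define s :: "nat \<Rightarrow> nat \<Rightarrow> 'k zpoly" where "s n = ghost_solve ?p (\<lambda>_. of_nat n)" for n
  have gs: "ghost ?p j (s n) = of_nat n" for j n
    unfolding s_def by (rule ghost_ghost_solve[OF p]) (simp add: dwork_def hom_of_nat[OF zfrob_hom])
  have one: "witt_nth (1 :: 'k witt) = (\<lambda>i. wred (if i = 0 then 1 else 0))"
    by transfer (simp add: fun_eq_iff)
  have of_nat: "witt_nth (of_nat n :: 'k witt) = (\<lambda>i. wred (s n i))" for n
  proof (induction n)
    case 0
    have "witt_nth (0 :: 'k witt) = (\<lambda>i. wred ((\<lambda>_. 0) i))" by transfer simp
    also have "\<dots> = (\<lambda>i. wred (s 0 i))"
      by (rule wred_eqI[OF p0]) (simp add: gs ghost_zero[OF p0])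
    finally show ?case by simp
  next
    case (Suc n)
    have "witt_nth (of_nat (Suc n) :: 'k witt) = wadd ?p (witt_nth 1) (witt_nth (of_nat n :: 'k witt))"
      by (simp add: plus_witt.rep_eq)
    also have "\<dots> = (\<lambda>i. wred (s (Suc n) i))"
      unfolding Suc.IH one wred_wadd
      by (rule wred_eqI[OF p0]) (simp add: gs ghost_wadd[OF p] ghost_one[OF p0])
    finally show ?case .
  qed
  have s0: "s ?p 0 = of_nat ?p" using gs[of 0 ?p] by (simp add: ghost_def)
  show "witt_nth (of_nat ?p :: 'k witt) 0 = 0"
    by (simp add: of_nat s0 hom_of_nat[OF ring_hom1_eval])
  have "of_nat ?p ^ ?p + of_nat ?p * s ?p 1 = (of_nat ?p :: 'k zpoly)"
    using gs[of 1 ?p] by (simp add: ghost_def s0)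
  moreover have "(of_nat ?p :: 'k zpoly) ^ ?p = of_nat ?p * of_nat ?p ^ (?p - 1)"
    using p0 by (simp flip: power_Suc)
  ultimately have "of_nat ?p * (of_nat ?p ^ (?p - 1) + s ?p 1) = of_nat ?p * (1 :: 'k zpoly)"
    by (simp add: distrib_left)
  then have "of_nat ?p ^ (?p - 1) + s ?p 1 = (1 :: 'k zpoly)"
    by (rule zpoly_cancel[OF p0])
  then have "wred (of_nat ?p ^ (?p - 1) + s ?p 1) = (1 :: 'k)" by simp
  moreover have "?p - 1 > 0" using prime_gt_1_nat[OF p] by simp
  ultimately show "witt_nth (of_nat ?p :: 'k witt) 1 = 1"
    by (simp add: of_nat zpoly_eval_add hom_power[OF ring_hom1_eval] hom_of_nat[OF ring_hom1_eval] power_0_left)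
qed

subsection \<open>Frobenius\<close>

lift_definition witt_frob :: "'k::comm_ring_prime_char witt \<Rightarrow> 'k witt" is "\<lambda>a n. a n ^ CHAR('k)" .

lemma ring_hom1_frob: "ring_hom1 (\<lambda>x::'a::comm_ring_prime_char. x ^ CHAR('a))"
  by (simp add: ring_hom1_def freshmans_dream power_mult_distrib)

lemma witt_frob_add: "witt_frob (a + b) = witt_frob a + witt_frob b"
  by transfer (rule ext, rule hom_wadd[OF ring_hom1_frob])

lemma witt_frob_mult: "witt_frob (a * b) = witt_frob a * witt_frob b"
  by transfer (rule ext, rule hom_wmult[OF ring_hom1_frob])

lemma witt_frob_0: "witt_frob 0 = (0 :: 'k::comm_ring_prime_char witt)"
  by transfer (simp add: fun_eq_iff power_0_left)

lemma witt_frob_1: "witt_frob 1 = (1 :: 'k::comm_ring_prime_char witt)"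
  by transfer (auto simp: fun_eq_iff power_0_left)

lemma witt_frob_eq_0_iff: "witt_frob a = 0 \<longleftrightarrow> a = (0 :: 'k::idom_prime_char witt)"
  by transfer (auto simp: fun_eq_iff)

lifting_forget witt.lifting

text \<open>The unique extension of \<open>\<sigma>\<close> to the fraction field.\<close>

definition fract_frob :: "'k::idom_prime_char witt fract \<Rightarrow> 'k witt fract" where
  "fract_frob x =
     (THE y. \<exists>a b. b \<noteq> 0 \<and> x = Fract a b \<and> y = Fract (witt_frob a) (witt_frob b))"

lemma fract_frob_Fract:
  assumes "b \<noteq> 0"
  shows "fract_frob (Fract a b) = Fract (witt_frob a) (witt_frob b)"
  unfolding fract_frob_def
proof (rule the_equality)
  show "\<exists>a' b'. b' \<noteq> 0 \<and> Fract a b = Fract a' b' \<and>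
      Fract (witt_frob a) (witt_frob b) = Fract (witt_frob a') (witt_frob b')"
    using assms by blast
next
  fix y
  assume "\<exists>a' b'. b' \<noteq> 0 \<and> Fract a b = Fract a' b' \<and> y = Fract (witt_frob a') (witt_frob b')"
  then obtain a' b' where *: "b' \<noteq> 0" "Fract a b = Fract a' b'" "y = Fract (witt_frob a') (witt_frob b')"
    by blast
  have "a * b' = a' * b" using *(2) assms *(1) by (simp add: eq_fract)
  then have "witt_frob a' * witt_frob b = witt_frob a * witt_frob b'"
    by (simp flip: witt_frob_mult)
  then show "y = Fract (witt_frob a) (witt_frob b)"
    using * assms by (simp add: eq_fract witt_frob_eq_0_iff)
qed


section \<open>The Dieudonne ring and its modules\<close>

subsection \<open>The ring \<open>D\<^sub>k\<close>, presented by generators and relations\<close>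

datatype 'k dexpr =
  EScal "'k witt" | EF | EV
  | EAdd "'k dexpr" "'k dexpr" | EMult "'k dexpr" "'k dexpr" | EMinus "'k dexpr"

inductive drel :: "'k::comm_ring_prime_char dexpr \<Rightarrow> 'k dexpr \<Rightarrow> bool" where
  drel_refl: "drel x x"
| drel_sym: "drel x y \<Longrightarrow> drel y x"
| drel_trans: "drel x y \<Longrightarrow> drel y z \<Longrightarrow> drel x z"
| drel_EAdd: "drel x x' \<Longrightarrow> drel y y' \<Longrightarrow> drel (EAdd x y) (EAdd x' y')"
| drel_EMult: "drel x x' \<Longrightarrow> drel y y' \<Longrightarrow> drel (EMult x y) (EMult x' y')"
| drel_EMinus: "drel x x' \<Longrightarrow> drel (EMinus x) (EMinus x')"
  \<comment> \<open>axioms of unital rings\<close>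
| drel_add_assoc: "drel (EAdd (EAdd x y) z) (EAdd x (EAdd y z))"
| drel_add_commute: "drel (EAdd x y) (EAdd y x)"
| drel_add_zero: "drel (EAdd (EScal 0) x) x"
| drel_add_minus: "drel (EAdd (EMinus x) x) (EScal 0)"
| drel_mult_assoc: "drel (EMult (EMult x y) z) (EMult x (EMult y z))"
| drel_mult_one_left: "drel (EMult (EScal 1) x) x"
| drel_mult_one_right: "drel (EMult x (EScal 1)) x"
| drel_distrib_right: "drel (EMult (EAdd x y) z) (EAdd (EMult x z) (EMult y z))"
| drel_distrib_left: "drel (EMult x (EAdd y z)) (EAdd (EMult x y) (EMult x z))"
  \<comment> \<open>\<open>W(k) \<rightarrow> D\<^sub>k\<close> is a ring homomorphism\<close>
| drel_scal_add: "drel (EScal (a + b)) (EAdd (EScal a) (EScal b))"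
| drel_scal_mult: "drel (EScal (a * b)) (EMult (EScal a) (EScal b))"
  \<comment> \<open>\<open>F w = \<sigma>(w) F\<close>, \<open>w V = V \<sigma>(w)\<close>, \<open>F V = V F = p\<close>\<close>
| drel_F: "drel (EMult EF (EScal w)) (EMult (EScal (witt_frob w)) EF)"
| drel_V: "drel (EMult (EScal w) EV) (EMult EV (EScal (witt_frob w)))"
| drel_FV: "drel (EMult EF EV) (EScal (of_nat CHAR('k)))"
| drel_VF: "drel (EMult EV EF) (EScal (of_nat CHAR('k)))"

quotient_type (overloaded) 'k dieudonne_ring = "'k::comm_ring_prime_char dexpr" / drel
proof (rule equivpI)
  show "reflp drel" by (rule reflpI) (rule drel_refl)
  show "symp drel" by (rule sympI) (rule drel_sym)
  show "transp drel" by (rule transpI) (rule drel_trans)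
qed

text \<open>The class \<open>ring_1\<close> is not used because it includes \<open>0 \<noteq> 1\<close>.\<close>

instantiation dieudonne_ring :: (comm_ring_prime_char) "{ring, monoid_mult}"
begin

lift_definition zero_dieudonne_ring :: "'a dieudonne_ring" is "EScal 0" .
lift_definition one_dieudonne_ring :: "'a dieudonne_ring" is "EScal 1" .
lift_definition plus_dieudonne_ring :: "'a dieudonne_ring \<Rightarrow> 'a dieudonne_ring \<Rightarrow> 'a dieudonne_ring"
  is EAdd by (rule drel_EAdd)
lift_definition times_dieudonne_ring :: "'a dieudonne_ring \<Rightarrow> 'a dieudonne_ring \<Rightarrow> 'a dieudonne_ring"
  is EMult by (rule drel_EMult)
lift_definition uminus_dieudonne_ring :: "'a dieudonne_ring \<Rightarrow> 'a dieudonne_ring"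
  is EMinus by (rule drel_EMinus)
definition minus_dieudonne_ring :: "'a dieudonne_ring \<Rightarrow> 'a dieudonne_ring \<Rightarrow> 'a dieudonne_ring"
  where "minus_dieudonne_ring a b = a + - b"

instance
proof
  fix a b c :: "'a dieudonne_ring"
  show "a + b + c = a + (b + c)" by transfer (rule drel_add_assoc)
  show "a + b = b + a" by transfer (rule drel_add_commute)
  show "0 + a = a" by transfer (rule drel_add_zero)
  show "- a + a = 0" by transfer (rule drel_add_minus)
  show "a - b = a + - b" by (rule minus_dieudonne_ring_def)
  show "a * b * c = a * (b * c)" by transfer (rule drel_mult_assoc)
  show "1 * a = a" by transfer (rule drel_mult_one_left)
  show "a * 1 = a" by transfer (rule drel_mult_one_right)
  show "(a + b) * c = a * c + b * c" by transfer (rule drel_distrib_right)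
  show "a * (b + c) = a * b + a * c" by transfer (rule drel_distrib_left)
qed

end

lift_definition dscal :: "'k::comm_ring_prime_char witt \<Rightarrow> 'k dieudonne_ring" is EScal .
lift_definition dF :: "'k::comm_ring_prime_char dieudonne_ring" is EF .
lift_definition dV :: "'k::comm_ring_prime_char dieudonne_ring" is EV .

lemma dieudonne_ring_relations:
  "dscal (a + b) = dscal a + dscal b" "dscal (a * b) = dscal a * dscal b"
  "dscal (0 :: 'k witt) = 0" "dscal (1 :: 'k witt) = 1"
  "dF * dscal w = dscal (witt_frob w) * dF" "dscal w * dV = dV * dscal (witt_frob w)"
  "dF * dV = dscal (of_nat CHAR('k) :: 'k witt)" "dV * dF = dscal (of_nat CHAR('k) :: 'k witt)"
  for w a b :: "'k::comm_ring_prime_char witt"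
proof -
  show "dscal (a + b) = dscal a + dscal b" by transfer (rule drel_scal_add)
  show "dscal (a * b) = dscal a * dscal b" by transfer (rule drel_scal_mult)
  show "dscal (0 :: 'k witt) = 0" by transfer (rule drel_refl)
  show "dscal (1 :: 'k witt) = 1" by transfer (rule drel_refl)
  show "dF * dscal w = dscal (witt_frob w) * dF" by transfer (rule drel_F)
  show "dscal w * dV = dV * dscal (witt_frob w)" by transfer (rule drel_V)
  show "dF * dV = dscal (of_nat CHAR('k) :: 'k witt)" by transfer (rule drel_FV)
  show "dV * dF = dscal (of_nat CHAR('k) :: 'k witt)" by transfer (rule drel_VF)
qed

lifting_forget dieudonne_ring.lifting

subsection \<open>The module \<open>A\<^sub>1\<^sub>,\<^sub>1 = D\<^sub>k / D\<^sub>k(F - V)\<close>\<close>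

quotient_type (overloaded) 'k A11 = "'k::comm_ring_prime_char dieudonne_ring" /
  "\<lambda>x y. \<exists>d. x - y = d * (dF - dV)"
proof (rule equivpI)
  let ?R = "\<lambda>x y :: 'k dieudonne_ring. \<exists>d. x - y = d * (dF - dV)"
  show "reflp ?R" by (rule reflpI) (auto intro: exI[of _ 0])
  show "symp ?R"
  proof (rule sympI)
    fix x y :: "'k dieudonne_ring" assume "?R x y"
    then obtain d where "x - y = d * (dF - dV)" by blast
    then have "y - x = - (d * (dF - dV))" by (simp flip: \<open>x - y = _\<close>)
    then have "y - x = (- d) * (dF - dV)" by simp
    then show "?R y x" by (rule exI)
  qed
  show "transp ?R"
  proof (rule transpI)
    fix x y z :: "'k dieudonne_ring" assume "?R x y" "?R y z"
    then obtain d e where "x - y = d * (dF - dV)" "y - z = e * (dF - dV)" by blast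
    then have "(x - y) + (y - z) = (d + e) * (dF - dV)" by (simp only: distrib_right)
    then have "x - z = (d + e) * (dF - dV)" by simp
    then show "?R x z" by (rule exI)
  qed
qed

instantiation A11 :: (comm_ring_prime_char) ab_group_add
begin

lift_definition zero_A11 :: "'a A11" is 0 .
lift_definition plus_A11 :: "'a A11 \<Rightarrow> 'a A11 \<Rightarrow> 'a A11" is "(+)"
proof -
  fix x x' y y' :: "'a dieudonne_ring"
  assume "\<exists>d. x - x' = d * (dF - dV)" "\<exists>d. y - y' = d * (dF - dV)"
  then obtain d e where "x - x' = d * (dF - dV)" "y - y' = e * (dF - dV)" by blast
  then have "x + y - (x' + y') = (d + e) * (dF - dV)" by (simp only: add_diff_add distrib_right)
  then show "\<exists>d. x + y - (x' + y') = d * (dF - dV)" by (rule exI)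
qed

lift_definition uminus_A11 :: "'a A11 \<Rightarrow> 'a A11" is uminus
proof -
  fix x x' :: "'a dieudonne_ring"
  assume "\<exists>d. x - x' = d * (dF - dV)"
  then obtain d where "x - x' = d * (dF - dV)" by blast
  then have "- x - - x' = (- d) * (dF - dV)" by (simp only: minus_diff_minus mult_minus_left)
  then show "\<exists>d. - x - - x' = d * (dF - dV)" by (rule exI)
qed

definition minus_A11 :: "'a A11 \<Rightarrow> 'a A11 \<Rightarrow> 'a A11" where "minus_A11 a b = a + - b"

instance
proof
  fix a b c :: "'a A11"
  show "a + b + c = a + (b + c)" by transfer (auto intro: exI[of _ 0] simp: add.assoc)
  show "a + b = b + a" by transfer (auto intro: exI[of _ 0] simp: add.commute)
  show "0 + a = a" by transfer (auto intro: exI[of _ 0])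
  show "- a + a = 0" by transfer (auto intro: exI[of _ 0])
  show "a - b = a + - b" by (rule minus_A11_def)
qed

end

lift_definition A11_act :: "'k::comm_ring_prime_char dieudonne_ring \<Rightarrow> 'k A11 \<Rightarrow> 'k A11" is "(*)"
proof -
  fix a x x' :: "'k dieudonne_ring"
  assume "\<exists>d. x - x' = d * (dF - dV)"
  then obtain d where "x - x' = d * (dF - dV)" by blast
  then have "a * x - a * x' = (a * d) * (dF - dV)"
    by (simp only: right_diff_distrib[of a x x', symmetric] mult.assoc)
  then show "\<exists>d. a * x - a * x' = d * (dF - dV)" by (rule exI)
qed

text \<open>The underlying set of \<open>A\<^sub>1\<^sub>,\<^sub>1\<^sup>g\<close>, as families indexed by \<open>i < g\<close>.\<close>

definition A11_power :: "nat \<Rightarrow> (nat \<Rightarrow> 'k::comm_ring_prime_char A11) set" where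
  "A11_power g = {c. \<forall>i\<ge>g. c i = 0}"

subsection \<open>Dieudonne modules\<close>

text \<open>Dieudonne modules \<open>M\<close> are realised inside \<open>M \<otimes> Frac(W(k))\<close>: the type \<open>'v\<close> is a vector space
  over \<open>Frac(W(k))\<close> with scalar multiplication \<open>smul\<close> and a compatible left
  \<open>D\<^sub>k\<close>-module structure \<open>act\<close>.\<close>

definition isocrystal ::
  "('k::idom_prime_char witt fract \<Rightarrow> 'v::ab_group_add \<Rightarrow> 'v) \<Rightarrow>
   ('k dieudonne_ring \<Rightarrow> 'v \<Rightarrow> 'v) \<Rightarrow> bool" where
  "isocrystal smul act \<longleftrightarrow>
     vector_space smul \<and>
     (\<forall>a x y. act a (x + y) = act a x + act a y) \<and>
     (\<forall>a b x. act (a + b) x = act a x + act b x) \<and>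
     (\<forall>a b x. act (a * b) x = act a (act b x)) \<and>
     (\<forall>x. act 1 x = x) \<and>
     (\<forall>w x. act (dscal w) x = smul (to_fract w) x)"

definition witt_comb ::
  "('k::idom_prime_char witt fract \<Rightarrow> 'v::ab_group_add \<Rightarrow> 'v) \<Rightarrow> nat \<Rightarrow> (nat \<Rightarrow> 'v) \<Rightarrow>
   (nat \<Rightarrow> 'k witt) \<Rightarrow> 'v" where
  "witt_comb smul n b w = (\<Sum>j<n. smul (to_fract (w j)) (b j))"

definition witt_basis ::
  "('k::idom_prime_char witt fract \<Rightarrow> 'v::ab_group_add \<Rightarrow> 'v) \<Rightarrow> nat \<Rightarrow> (nat \<Rightarrow> 'v) \<Rightarrow>
   'v set \<Rightarrow> bool" where
  "witt_basis smul n b M \<longleftrightarrow>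
     M = range (witt_comb smul n b) \<and>
     (\<forall>w. witt_comb smul n b w = 0 \<longrightarrow> (\<forall>j<n. w j = 0))"

text \<open>The last condition says that \<open>M \<otimes> Frac(W(k))\<close> is all of the ambient space.\<close>

definition dieudonne_module ::
  "('k::idom_prime_char witt fract \<Rightarrow> 'v::ab_group_add \<Rightarrow> 'v) \<Rightarrow>
   ('k dieudonne_ring \<Rightarrow> 'v \<Rightarrow> 'v) \<Rightarrow> nat \<Rightarrow> 'v set \<Rightarrow> bool" where
  "dieudonne_module smul act r M \<longleftrightarrow>
     0 \<in> M \<and> (\<forall>x\<in>M. \<forall>y\<in>M. x + y \<in> M) \<and> (\<forall>a. \<forall>x\<in>M. act a x \<in> M) \<and>
     (\<exists>b. witt_basis smul r b M) \<and>
     (\<forall>x. \<exists>s. s \<noteq> 0 \<and> smul (to_fract s) x \<in> M)"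

definition A11_power_hom ::
  "('k::comm_ring_prime_char dieudonne_ring \<Rightarrow> 'v::ab_group_add \<Rightarrow> 'v) \<Rightarrow> nat \<Rightarrow>
   ((nat \<Rightarrow> 'k A11) \<Rightarrow> 'v) \<Rightarrow> bool" where
  "A11_power_hom act g \<phi> \<longleftrightarrow>
     (\<forall>c\<in>A11_power g. \<forall>d\<in>A11_power g. \<phi> (\<lambda>i. c i + d i) = \<phi> c + \<phi> d) \<and>
     (\<forall>a. \<forall>c\<in>A11_power g. \<phi> (\<lambda>i. A11_act a (c i)) = act a (\<phi> c))"

definition iso_A11_power ::
  "('k::comm_ring_prime_char dieudonne_ring \<Rightarrow> 'v::ab_group_add \<Rightarrow> 'v) \<Rightarrow> nat \<Rightarrow>
   'v set \<Rightarrow> bool" where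
  "iso_A11_power act g M \<longleftrightarrow>
     (\<exists>\<phi>. A11_power_hom act g \<phi> \<and> bij_betw \<phi> (A11_power g) M)"

text \<open>A supersingular abelian variety of dimension \<open>g\<close> is one isogenous to \<open>E\<^sup>g\<close> with \<open>E\<close> a
  supersingular elliptic curve, and the Dieudonne module of \<open>E\<close> is \<open>A\<^sub>1\<^sub>,\<^sub>1\<close>; so \<open>M\<close> is
  supersingular iff it is isogenous to \<open>A\<^sub>1\<^sub>,\<^sub>1\<^sup>g\<close>, i.e. receives an injection from it whose
  cokernel is killed by a power of \<open>p\<close>.\<close>

definition supersingular ::
  "('k::idom_prime_char witt fract \<Rightarrow> 'v::ab_group_add \<Rightarrow> 'v) \<Rightarrow>
   ('k dieudonne_ring \<Rightarrow> 'v \<Rightarrow> 'v) \<Rightarrow> nat \<Rightarrow> 'v set \<Rightarrow> bool" where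
  "supersingular smul act g M \<longleftrightarrow>
     (\<exists>\<phi> n. A11_power_hom act g \<phi> \<and> inj_on \<phi> (A11_power g) \<and> \<phi> ` A11_power g \<subseteq> M \<and>
        (\<forall>x\<in>M. smul (of_nat CHAR('k) ^ n) x \<in> \<phi> ` A11_power g))"

subsection \<open>Quasi-polarisations and duals\<close>

text \<open>The form is given by its \<open>Frac(W(k))\<close>-bilinear extension to \<open>M \<otimes> Frac(W(k))\<close>.\<close>

definition quasi_polarised ::
  "('k::idom_prime_char witt fract \<Rightarrow> 'v::ab_group_add \<Rightarrow> 'v) \<Rightarrow>
   ('k dieudonne_ring \<Rightarrow> 'v \<Rightarrow> 'v) \<Rightarrow> ('v \<Rightarrow> 'v \<Rightarrow> 'k witt fract) \<Rightarrow> 'v set \<Rightarrow> bool" where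
  "quasi_polarised smul act B M \<longleftrightarrow>
     (\<forall>x. Vector_Spaces.linear smul (*) (B x)) \<and>
     (\<forall>y. Vector_Spaces.linear smul (*) (\<lambda>x. B x y)) \<and>
     (\<forall>x\<in>M. B x x = 0) \<and>
     (\<forall>x\<in>M. (\<forall>y\<in>M. B x y = 0) \<longrightarrow> x = 0) \<and>
     (\<forall>x\<in>M. \<forall>y\<in>M. B (act dF x) y = fract_frob (B x (act dV y)))"

text \<open>\<open>M\<^sup>t\<close> as a subset of \<open>M \<otimes> Frac(W(k))\<close>.\<close>

definition dual_module :: "('v \<Rightarrow> 'v \<Rightarrow> 'k::idom_prime_char witt fract) \<Rightarrow> 'v set \<Rightarrow> 'v set" where
  "dual_module B M = {y. \<forall>x\<in>M. B x y \<in> range to_fract}"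

text \<open>The element \<open>y\<^sub>b\<close> representing a functional \<open>b \<in> M\<^sup>t = Hom(M, W(k))\<close>, and the induced
  quasi-polarisation on \<open>M\<^sup>t\<close>.\<close>

definition dual_vec ::
  "('v \<Rightarrow> 'v \<Rightarrow> 'k::idom_prime_char witt fract) \<Rightarrow> 'v set \<Rightarrow> ('v \<Rightarrow> 'k witt) \<Rightarrow> 'v" where
  "dual_vec B M b = (THE y. \<forall>m\<in>M. to_fract (b m) = B m y)"

definition dual_form ::
  "('v \<Rightarrow> 'v \<Rightarrow> 'k::idom_prime_char witt fract) \<Rightarrow> 'v set \<Rightarrow>
   ('v \<Rightarrow> 'k witt) \<Rightarrow> ('v \<Rightarrow> 'k witt) \<Rightarrow> 'k witt fract" where
  "dual_form B M a b = B (dual_vec B M a) (dual_vec B M b)"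

definition dual_basis ::
  "('k::idom_prime_char witt fract \<Rightarrow> 'v::ab_group_add \<Rightarrow> 'v) \<Rightarrow> nat \<Rightarrow> (nat \<Rightarrow> 'v) \<Rightarrow>
   nat \<Rightarrow> 'v \<Rightarrow> 'k witt" where
  "dual_basis smul n b i = (\<lambda>x. THE c. \<exists>w. x = witt_comb smul n b w \<and> c = w i)"

definition gram_matrix :: "('v \<Rightarrow> 'v \<Rightarrow> 'a) \<Rightarrow> nat \<Rightarrow> (nat \<Rightarrow> 'v) \<Rightarrow> 'a mat" where
  "gram_matrix q n b = mat n n (\<lambda>(i, j). q (b i) (b j))"

subsection \<open>Polarised flag type quotients\<close>

text \<open>\<open>dim\<^sub>k(M/M') = n\<close>, where \<open>k = W(k)/p\<close> acts on \<open>M/M'\<close> through representatives in \<open>W(k)\<close>;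
  \<open>witt_nth w 0\<close> is the residue class of \<open>w\<close>.\<close>

definition quotient_dim ::
  "('k::idom_prime_char witt fract \<Rightarrow> 'v::ab_group_add \<Rightarrow> 'v) \<Rightarrow> 'v set \<Rightarrow> 'v set \<Rightarrow> nat \<Rightarrow> bool" where
  "quotient_dim smul M M' n \<longleftrightarrow>
     (\<forall>x\<in>M. smul (of_nat CHAR('k)) x \<in> M') \<and>
     (\<exists>b. (\<forall>j<n. b j \<in> M) \<and>
        (\<forall>x\<in>M. \<exists>w. x - witt_comb smul n b w \<in> M') \<and>
        (\<forall>w. witt_comb smul n b w \<in> M' \<longrightarrow> (\<forall>j<n. witt_nth (w j) 0 = 0)))"

definition pftq ::
  "('k::idom_prime_char witt fract \<Rightarrow> 'v::ab_group_add \<Rightarrow> 'v) \<Rightarrow>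
   ('k dieudonne_ring \<Rightarrow> 'v \<Rightarrow> 'v) \<Rightarrow> ('v \<Rightarrow> 'v \<Rightarrow> 'k witt fract) \<Rightarrow> nat \<Rightarrow>
   (nat \<Rightarrow> 'v set) \<Rightarrow> bool" where
  "pftq smul act B g M \<longleftrightarrow>
     g \<ge> 1 \<and> isocrystal smul act \<and>
     (\<forall>i\<le>g-1. dieudonne_module smul act (2 * g) (M i) \<and> supersingular smul act g (M i) \<and>
        quasi_polarised smul act B (M i)) \<and>
     (\<forall>i\<in>{1..g-1}. M (i-1) \<subseteq> M i) \<and>
     iso_A11_power act g (M (g-1)) \<and>
     dual_module B (M (g-1)) = act (dF ^ (g-1)) ` M (g-1) \<and>
     (\<forall>i\<in>{1..g-1}. act dF ` M i \<subseteq> M (i-1) \<and> act dV ` M i \<subseteq> M (i-1) \<and>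
        quotient_dim smul (M i) (M (i-1)) i) \<and>
     (\<forall>i\<le>g-1. \<forall>j\<le>i div 2. act (dF ^ (i-j) * dV ^ j) ` M i \<subseteq> dual_module B (M i))"

subsection \<open>Normal-form bases\<close>

text \<open>The family \<open>e\<^sub>1, f\<^sub>1, e\<^sub>2, f\<^sub>2, \<dots>\<close>, with all indices starting at 0.\<close>

definition interleave :: "(nat \<Rightarrow> 'v) \<Rightarrow> (nat \<Rightarrow> 'v) \<Rightarrow> nat \<Rightarrow> 'v" where
  "interleave e f j = (if even j then e (j div 2) else f (j div 2))"

definition odd_block :: "'a::ring_1 \<Rightarrow> 'a mat" where
  "odd_block a = mat_of_rows_list 2 [[0, a], [- a, 0]]"

definition even_block :: "'a::ring_1 \<Rightarrow> 'a \<Rightarrow> 'a mat" where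
  "even_block a b = mat_of_rows_list 4
     [[0, 0, a, 0], [0, 0, 0, b], [- a, 0, 0, 0], [0, - b, 0, 0]]"

definition normal_form_basis ::
  "('k::idom_prime_char witt fract \<Rightarrow> 'v::ab_group_add \<Rightarrow> 'v) \<Rightarrow>
   ('k dieudonne_ring \<Rightarrow> 'v \<Rightarrow> 'v) \<Rightarrow> ('v \<Rightarrow> 'v \<Rightarrow> 'k witt fract) \<Rightarrow> nat \<Rightarrow> 'v set \<Rightarrow>
   (nat \<Rightarrow> 'v) \<Rightarrow> (nat \<Rightarrow> 'v) \<Rightarrow> bool" where
  "normal_form_basis smul act B g M e f \<longleftrightarrow>
     (let p = of_nat CHAR('k) :: 'k witt fract;
          b = interleave e f;
          dual_gram = gram_matrix (dual_form B M) (2 * g) (dual_basis smul (2 * g) b)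
      in witt_basis smul (2 * g) b M \<and>
        (odd g \<longrightarrow>
           (\<forall>i<g. act dF (e i) = f i \<and> act dV (e i) = - f i \<and>
              act dF (f i) = - smul p (e i) \<and> act dV (f i) = smul p (e i)) \<and>
           dual_gram = diag_block_mat (replicate g (odd_block (p ^ ((g - 1) div 2))))) \<and>
        (even g \<longrightarrow>
           (\<forall>i<g. act dF (e i) = f i \<and> act dV (e i) = f i \<and>
              act dF (f i) = smul p (e i) \<and> act dV (f i) = smul p (e i)) \<and>
           dual_gram =
             diag_block_mat (replicate (g div 2) (even_block (p ^ (g div 2)) (p ^ (g div 2 - 1))))))"

end

theory Submission
  imports Defs "Jordan_Normal_Form.Determinant"
begin

text \<open>
  The corollary is a statement about Gram matrices. Let \<open>G\<close> be the Gram matrix of a non-degenerate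
  form in a basis \<open>b\<^sub>1, \<dots>, b\<^sub>n\<close> of a lattice. The vectors \<open>y\<^sub>1, \<dots>, y\<^sub>n\<close> representing the dual basis
  satisfy \<open>\<langle>b\<^sub>j, y\<^sub>i\<rangle> = \<delta>\<^sub>i\<^sub>j\<close>, so the coordinates of \<open>y\<^sub>i\<close> are the \<open>i\<close>-th column of \<open>G\<^sup>-\<^sup>1\<close>, and
  \<open>\<langle>y\<^sub>i, y\<^sub>j\<rangle>\<close> is the \<open>(j, i)\<close> entry of \<open>G\<^sup>-\<^sup>1\<close>. Thus the Gram matrix \<open>D\<close> of the dual basis is the
  transpose of \<open>G\<^sup>-\<^sup>1\<close>, equivalently \<open>G D\<^sup>T = 1\<close> (lemma \<open>gram_matrix_mult_dual\<close>). For a normal-form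
  basis \<open>D\<close> is block diagonal with explicit antisymmetric monomial blocks, and the inverse transpose
  of such a block is obtained by inverting its non-zero entries in place: the sign coming from the
  inversion cancels against the one coming from the transposition. So \<open>G\<close> has the same shape as
  \<open>D\<close>, with every power of \<open>p\<close> inverted.

  The dual vectors exist in \<open>M \<otimes> Frac(W(k))\<close>, and are unique there, because a
  \<open>W(k)\<close>-basis of \<open>M\<close> is a \<open>Frac(W(k))\<close>-basis of the ambient space: denominators can be cleared.
  Hence non-degeneracy of the form on \<open>M\<close> makes \<open>G\<close> invertible over \<open>Frac(W(k))\<close>.
\<close>

section \<open>Block diagonal matrices with equal blocks\<close>

lemma diag_block_replicate_carrier:
  assumes "A \<in> carrier_mat m n"
  shows "diag_block_mat (replicate r A) \<in> carrier_mat (r * m) (r * n)"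
  using assms by (intro carrier_matI) (simp_all add: dim_diag_block_mat sum_list_replicate)

lemma transpose_diag_block_replicate:
  assumes A: "A \<in> carrier_mat m n"
  shows "transpose_mat (diag_block_mat (replicate r A)) = diag_block_mat (replicate r (transpose_mat A))"
proof (induction r)
  case 0
  show ?case by simp
next
  case (Suc r)
  have D: "diag_block_mat (replicate r A) \<in> carrier_mat (r * m) (r * n)"
    using A by (rule diag_block_replicate_carrier)
  then have D': "diag_block_mat (replicate r (transpose_mat A)) \<in> carrier_mat (r * n) (r * m)"
    by (simp flip: Suc.IH)
  show ?case
    using A D D' by (simp add: Let_def transpose_four_block_mat[OF A _ _ D] Suc.IH)
qed

lemma diag_block_replicate_mult_inverse:
  assumes A: "A \<in> carrier_mat m m" and C: "C \<in> carrier_mat m m" and AC: "A * C = 1\<^sub>m m"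
  shows "diag_block_mat (replicate r A) * diag_block_mat (replicate r C) = 1\<^sub>m (r * m)"
proof (induction r)
  case 0
  show ?case by auto
next
  case (Suc r)
  let ?D = "diag_block_mat (replicate r A)" and ?E = "diag_block_mat (replicate r C)"
  have D: "?D \<in> carrier_mat (r * m) (r * m)" and E: "?E \<in> carrier_mat (r * m) (r * m)"
    using A C by (auto intro: diag_block_replicate_carrier)
  have "diag_block_mat (replicate (Suc r) A) * diag_block_mat (replicate (Suc r) C) =
      four_block_mat (A * C) (0\<^sub>m m (r * m)) (0\<^sub>m (r * m) m) (?D * ?E)"
    using A C D E
    by (simp add: Let_def mult_four_block_mat[OF A _ _ D C _ _ E])
  then show ?case by (simp add: AC Suc.IH)
qed

lemma odd_block_carrier: "odd_block a \<in> carrier_mat 2 2"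
  by (intro carrier_matI) (simp_all add: odd_block_def mat_of_rows_list_def)

lemma even_block_carrier: "even_block a b \<in> carrier_mat 4 4"
  by (intro carrier_matI) (simp_all add: even_block_def mat_of_rows_list_def)

text \<open>Each non-zero entry is alone in its row and column, so transposing and inverting the block
  inverts these entries in place; the signs agree because they are their own inverses.\<close>

lemma odd_block_inverse_transpose:
  fixes a :: "'a::field"
  assumes "a \<noteq> 0"
  shows "transpose_mat (odd_block a) * odd_block (inverse a) = 1\<^sub>m 2"
  using assms
  by (intro eq_matI)
    (auto simp: odd_block_def mat_of_rows_list_def scalar_prod_def numeral_eq_Suc less_Suc_eq)

lemma even_block_inverse_transpose:
  fixes a b :: "'a::field"
  assumes "a \<noteq> 0" "b \<noteq> 0"
  shows "transpose_mat (even_block a b) * even_block (inverse a) (inverse b) = 1\<^sub>m 4"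
  using assms
  by (intro eq_matI)
    (auto simp: even_block_def mat_of_rows_list_def scalar_prod_def numeral_eq_Suc less_Suc_eq)

text \<open>A left inverse of a matrix equals any right inverse of it, and \<open>diag(C, \<dots>, C)\<close> is a right inverse of
  \<open>diag(A, \<dots>, A)\<^sup>T\<close> block by block.\<close>

lemma eq_diag_block_replicate_inverse_transpose:
  fixes G :: "'a::field mat"
  assumes G: "G \<in> carrier_mat (r * m) (r * m)"
    and A: "A \<in> carrier_mat m m" and C: "C \<in> carrier_mat m m"
    and AC: "transpose_mat A * C = 1\<^sub>m m"
    and GD: "G * transpose_mat (diag_block_mat (replicate r A)) = 1\<^sub>m (r * m)"
  shows "G = diag_block_mat (replicate r C)"
proof -
  let ?D = "diag_block_mat (replicate r (transpose_mat A))"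
  let ?E = "diag_block_mat (replicate r C)"
  have D: "?D \<in> carrier_mat (r * m) (r * m)" and E: "?E \<in> carrier_mat (r * m) (r * m)"
    using A C by (auto intro: diag_block_replicate_carrier)
  have DE: "?D * ?E = 1\<^sub>m (r * m)"
    using A C AC by (intro diag_block_replicate_mult_inverse) auto
  have "G = G * (?D * ?E)" using G by (simp add: DE)
  also have "\<dots> = (G * ?D) * ?E" using G D E by simp
  also have "G * ?D = 1\<^sub>m (r * m)"
    using GD by (simp add: transpose_diag_block_replicate[OF A])
  also have "1\<^sub>m (r * m) * ?E = ?E" using E by simp
  finally show ?thesis .
qed

section \<open>Witt vector bases as bases over the fraction field\<close>

lemma common_denominator:
  fixes c :: "nat \<Rightarrow> 'a::idom fract"
  shows "\<exists>s w. s \<noteq> 0 \<and> (\<forall>k<n. to_fract s * c k = to_fract (w k))"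
proof (induction n)
  case 0
  show ?case by (intro exI[of _ 1]) simp
next
  case (Suc n)
  then obtain s w where s: "s \<noteq> 0" and w: "\<And>k. k < n \<Longrightarrow> to_fract s * c k = to_fract (w k)"
    by blast
  obtain a d where cn: "c n = Fract a d" and d: "d \<noteq> 0" by (cases "c n") auto
  have dcn: "to_fract d * c n = to_fract a"
    using d by (simp add: cn to_fract_def eq_fract)
  show ?case
  proof (intro exI conjI allI impI)
    show "s * d \<noteq> 0" using s d by simp
    fix k assume "k < Suc n"
    then show "to_fract (s * d) * c k = to_fract (if k = n then s * a else d * w k)"
      using w[of k] dcn by (auto simp: less_Suc_eq mult.assoc mult.left_commute)
  qed
qed

text \<open>Only non-degeneracy in the left argument is assumed: for a form on a module of finite rank it
  implies non-degeneracy in the right argument, because the determinant of the Gram matrix does not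
  change under transposition.\<close>

locale polarised_lattice =
  fixes smul :: "'k::idom_prime_char witt fract \<Rightarrow> 'v::ab_group_add \<Rightarrow> 'v"
    and B :: "'v \<Rightarrow> 'v \<Rightarrow> 'k witt fract"
    and n :: nat
    and b :: "nat \<Rightarrow> 'v"
    and M :: "'v set"
  assumes vector_space: "vector_space smul"
    and basis: "witt_basis smul n b M"
    and spans: "\<exists>s. s \<noteq> 0 \<and> smul (to_fract s) x \<in> M"
    and linear_right: "Vector_Spaces.linear smul (*) (B x)"
    and linear_left: "Vector_Spaces.linear smul (*) (\<lambda>x. B x y)"
    and nondegenerate: "x \<in> M \<Longrightarrow> (\<And>y. y \<in> M \<Longrightarrow> B x y = 0) \<Longrightarrow> x = 0"
begin

sublocale vector_space smul by (rule vector_space)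

definition comb :: "(nat \<Rightarrow> 'k witt fract) \<Rightarrow> 'v" where
  "comb c = (\<Sum>k<n. smul (c k) (b k))"

definition G :: "'k witt fract mat" where "G = gram_matrix B n b"

lemma G_carrier: "G \<in> carrier_mat n n"
  by (simp add: G_def gram_matrix_def)

lemma G_index: "i < n \<Longrightarrow> j < n \<Longrightarrow> G $$ (i, j) = B (b i) (b j)"
  by (simp add: G_def gram_matrix_def)

lemma form_comb_right: "B x (comb c) = (\<Sum>k<n. c k * B x (b k))"
proof -
  interpret Vector_Spaces.linear smul "(*)" "B x" by (rule linear_right)
  show ?thesis by (simp add: comb_def sum scale)
qed

lemma form_comb_left: "B (comb c) y = (\<Sum>k<n. c k * B (b k) y)"
proof -
  interpret Vector_Spaces.linear smul "(*)" "\<lambda>x. B x y" by (rule linear_left)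
  show ?thesis by (simp add: comb_def sum scale)
qed

lemma form_scale_left: "B (smul a x) y = a * B x y"
proof -
  interpret Vector_Spaces.linear smul "(*)" "\<lambda>x. B x y" by (rule linear_left)
  show ?thesis by (rule scale)
qed

lemma form_diff_right: "B x (y - z) = B x y - B x z"
proof -
  interpret Vector_Spaces.linear smul "(*)" "B x" by (rule linear_right)
  show ?thesis by (rule diff)
qed

lemma smul_comb: "smul a (comb c) = comb (\<lambda>k. a * c k)"
  by (simp add: comb_def scale_sum_right)

lemma comb_delta: "j < n \<Longrightarrow> comb (\<lambda>k. if k = j then 1 else 0) = b j"
  by (simp add: comb_def if_distrib[of "\<lambda>a. smul a _"] cong: if_cong)

lemma witt_comb_eq: "witt_comb smul n b w = comb (\<lambda>k. to_fract (w k))"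
  by (simp add: witt_comb_def comb_def)

lemma lattice_eq: "M = range (\<lambda>w. comb (\<lambda>k. to_fract (w k)))"
  using basis by (simp add: witt_basis_def witt_comb_eq image_def)

lemma basis_mem: "j < n \<Longrightarrow> b j \<in> M"
  unfolding lattice_eq
  by (rule range_eqI[of _ _ "\<lambda>k. if k = j then 1 else 0"])
    (simp add: if_distrib[of to_fract] comb_delta cong: if_cong)

text \<open>Multiplying by a common denominator turns a relation over the fraction field into one over
  \<open>W(k)\<close>.\<close>

lemma comb_eq_0:
  assumes "comb c = 0" "k < n"
  shows "c k = 0"
proof -
  obtain s w where s: "s \<noteq> 0" and w: "\<And>k. k < n \<Longrightarrow> to_fract s * c k = to_fract (w k)"
    using common_denominator[of n c] by blast
  have "witt_comb smul n b w = smul (to_fract s) (comb c)"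
    unfolding witt_comb_eq smul_comb by (simp add: comb_def w)
  then have "w k = 0" using basis assms by (auto simp: witt_basis_def)
  with w[OF assms(2)] s show ?thesis by simp
qed

text \<open>A multiple of \<open>x\<close> lies in the lattice, and the scalar can be divided out again.\<close>

lemma comb_surj: "\<exists>c. x = comb c"
proof -
  obtain s where s: "s \<noteq> 0" and "smul (to_fract s) x \<in> M" using spans by blast
  then obtain w where w: "smul (to_fract s) x = comb (\<lambda>k. to_fract (w k))"
    unfolding lattice_eq by blast
  have "x = smul (inverse (to_fract s)) (smul (to_fract s) x)" using s by simp
  also have "\<dots> = comb (\<lambda>k. inverse (to_fract s) * to_fract (w k))"
    unfolding w smul_comb ..
  finally show ?thesis by blast
qed

lemma dual_basis_comb:
  assumes "i < n"
  shows "dual_basis smul n b i (comb (\<lambda>k. to_fract (w k))) = w i"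
  unfolding dual_basis_def
proof (rule the_equality)
  show "\<exists>w'. comb (\<lambda>k. to_fract (w k)) = witt_comb smul n b w' \<and> w i = w' i"
    by (auto simp: witt_comb_eq)
  fix c assume "\<exists>w'. comb (\<lambda>k. to_fract (w k)) = witt_comb smul n b w' \<and> c = w' i"
  then obtain w' where w': "comb (\<lambda>k. to_fract (w k)) = comb (\<lambda>k. to_fract (w' k))" "c = w' i"
    by (auto simp: witt_comb_eq)
  have "comb (\<lambda>k. to_fract (w' k) - to_fract (w k)) = 0"
    using w'(1) by (simp add: comb_def scale_left_diff_distrib sum_subtractf)
  from comb_eq_0[OF this assms] show "c = w i" using w'(2) by simp
qed

section \<open>The Gram matrix of the dual basis\<close>

text \<open>A vector in the left kernel of \<open>G\<close> is a vector of the ambient space orthogonal to \<open>M\<close>, and some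
  multiple of it lies in \<open>M\<close>.\<close>

lemma det_G: "det G \<noteq> 0"
proof
  assume "det G = 0"
  then have "det (transpose_mat G) = 0" using det_transpose[OF G_carrier] by simp
  then obtain v where v: "v \<in> carrier_vec n" "v \<noteq> 0\<^sub>v n" "transpose_mat G *\<^sub>v v = 0\<^sub>v n"
    using det_0_iff_vec_prod_zero_field[of "transpose_mat G" n] G_carrier by auto
  define x where "x = comb (\<lambda>k. v $ k)"
  have orth: "B x (b j) = 0" if "j < n" for j
  proof -
    have "B x (b j) = (transpose_mat G *\<^sub>v v) $ j"
      using that v(1) G_carrier
      by (simp add: x_def form_comb_left scalar_prod_def G_index atLeast0LessThan mult.commute)
    then show ?thesis using that v(3) by simp
  qed
  obtain s where s: "s \<noteq> 0" "smul (to_fract s) x \<in> M" using spans by blast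
  have "smul (to_fract s) x = 0"
  proof (rule nondegenerate[OF s(2)])
    fix y
    obtain c where "y = comb c" using comb_surj by blast
    then show "B (smul (to_fract s) x) y = 0" by (simp add: form_scale_left form_comb_right orth)
  qed
  then have "x = 0" using s(1) by simp
  then have "v $ k = 0" if "k < n" for k using comb_eq_0 that unfolding x_def by blast
  then have "v = 0\<^sub>v n" using v(1) by auto
  with v(2) show False ..
qed

lemma G_inverse:
  obtains H where "H \<in> carrier_mat n n" "G * H = 1\<^sub>m n"
  using det_non_zero_imp_unit[OF G_carrier det_G, of "()"]
  by (auto simp: Units_def ring_mat_def)

lemma right_nondegenerate:
  assumes "\<And>j. j < n \<Longrightarrow> B (b j) z = 0"
  shows "z = 0"
proof -
  obtain c where z: "z = comb c" using comb_surj by blast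
  have "G *\<^sub>v vec n c = 0\<^sub>v n"
  proof (rule eq_vecI)
    fix j assume "j < dim_vec (0\<^sub>v n :: 'k witt fract vec)"
    then show "(G *\<^sub>v vec n c) $ j = 0\<^sub>v n $ j"
      using assms[of j] G_carrier
      by (simp add: z form_comb_right scalar_prod_def G_index atLeast0LessThan mult.commute)
  qed (use G_carrier in simp)
  then have "vec n c = 0\<^sub>v n"
    using det_0_iff_vec_prod_zero_field[OF G_carrier] det_G by (metis vec_carrier)
  then have "c k = 0" if "k < n" for k using that by (metis index_vec index_zero_vec(1))
  then show ?thesis by (simp add: z comb_def)
qed

text \<open>This resolves the definite description in \<open>dual_vec\<close>: being dual to the basis pins down the values on
  all of \<open>M\<close> by linearity, and right non-degeneracy gives uniqueness.\<close>

lemma dual_vec_dual_basis: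
  assumes i: "i < n" and y: "\<And>j. j < n \<Longrightarrow> B (b j) y = (if i = j then 1 else 0)"
  shows "dual_vec B M (dual_basis smul n b i) = y"
  unfolding dual_vec_def
proof (rule the_equality)
  show *: "\<forall>m\<in>M. to_fract (dual_basis smul n b i m) = B m y"
  proof
    fix m assume "m \<in> M"
    then obtain w where m: "m = comb (\<lambda>k. to_fract (w k))" unfolding lattice_eq by blast
    have "B m y = to_fract (w i)"
      using i by (simp add: m form_comb_left y if_distrib[of "\<lambda>a. _ * a"] cong: if_cong)
    then show "to_fract (dual_basis smul n b i m) = B m y"
      by (simp add: m dual_basis_comb[OF i])
  qed
  fix y' assume y': "\<forall>m\<in>M. to_fract (dual_basis smul n b i m) = B m y'"
  have "y' - y = 0"
  proof (rule right_nondegenerate)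
    fix j assume "j < n"
    then have "B (b j) y' = B (b j) y" using * y' basis_mem by metis
    then show "B (b j) (y' - y) = 0" by (simp add: form_diff_right)
  qed
  then show "y' = y" by simp
qed

text \<open>The vectors \<open>y i\<close> whose coordinates are the columns of \<open>G\<^sup>-\<^sup>1\<close> represent the dual basis. Expanding
  only one argument of \<open>B (y j) (y i)\<close> in the basis already gives an entry of \<open>G\<^sup>-\<^sup>1\<close>, since the other
  argument is dual to it.\<close>

lemma gram_matrix_mult_dual:
  "G * transpose_mat (gram_matrix (dual_form B M) n (dual_basis smul n b)) = 1\<^sub>m n"
proof -
  obtain H where H: "H \<in> carrier_mat n n" and GH: "G * H = 1\<^sub>m n" using G_inverse by blast
  define y where "y i = comb (\<lambda>k. H $$ (k, i))" for i
  have By: "B (b j) (y i) = (if i = j then 1 else 0)" if "i < n" "j < n" for i j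
  proof -
    have "B (b j) (y i) = (G * H) $$ (j, i)"
      using that H G_carrier
      by (simp add: y_def form_comb_right scalar_prod_def G_index atLeast0LessThan mult.commute)
    then show ?thesis using that by (auto simp: GH)
  qed
  have dv: "dual_vec B M (dual_basis smul n b i) = y i" if "i < n" for i
    using that By by (intro dual_vec_dual_basis) auto
  have "transpose_mat (gram_matrix (dual_form B M) n (dual_basis smul n b)) = H"
  proof (rule eq_matI)
    fix i j assume "i < dim_row H" "j < dim_col H"
    then have ij: "i < n" "j < n" using H by auto
    have "B (y j) (y i) = H $$ (i, j)"
      using ij by (subst y_def[of j])
        (simp add: form_comb_left By if_distrib[of "\<lambda>a. _ * a"] cong: if_cong)
    then show "transpose_mat (gram_matrix (dual_form B M) n (dual_basis smul n b)) $$ (i, j) = H $$ (i, j)"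
      using ij by (simp add: gram_matrix_def dual_form_def dv)
  qed (use H in \<open>simp_all add: gram_matrix_def\<close>)
  then show ?thesis using GH by simp
qed

end

section \<open>Normal-form bases\<close>

text \<open>The inversion needs \<open>p \<noteq> 0\<close>, which holds because \<open>p\<close> has component 1 at index 1.\<close>

lemma CHAR_witt_fract_nonzero: "(of_nat CHAR('k) :: 'k::idom_prime_char witt fract) \<noteq> 0"
proof
  assume "(of_nat CHAR('k) :: 'k witt fract) = 0"
  then have "to_fract (of_nat CHAR('k) :: 'k witt) = 0"
    by (simp add: to_fract_def Fract_of_nat_eq)
  then have "(of_nat CHAR('k) :: 'k witt) = 0" by simp
  then have "witt_nth (0 :: 'k witt) 1 = 1" using witt_nth_CHAR(2) by metis
  then show False by (simp add: zero_witt.rep_eq)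
qed

theorem corollary4p2:
  fixes smul :: "'k::{alg_closed_field, field_prime_char} witt fract \<Rightarrow> 'v::ab_group_add \<Rightarrow> 'v"
    and act :: "'k dieudonne_ring \<Rightarrow> 'v \<Rightarrow> 'v"
    and B :: "'v \<Rightarrow> 'v \<Rightarrow> 'k witt fract"
    and g :: nat
    and M :: "nat \<Rightarrow> 'v set"
    and e f :: "nat \<Rightarrow> 'v"
  assumes "pftq smul act B g M"
    and "normal_form_basis smul act B g (M (g - 1)) e f"
  shows "(odd g \<longrightarrow>
            gram_matrix B (2 * g) (interleave e f) =
              diag_block_mat (replicate g
                (odd_block (of_nat CHAR('k) powi (- int ((g - 1) div 2)))))) \<and>
         (even g \<longrightarrow>
            gram_matrix B (2 * g) (interleave e f) =
              diag_block_mat (replicate (g div 2)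
                (even_block (of_nat CHAR('k) powi (- int (g div 2)))
                  (of_nat CHAR('k) powi (- int (g div 2) + 1)))))"
proof -
  let ?p = "of_nat CHAR('k) :: 'k witt fract"
  let ?M = "M (g - 1)" and ?b = "interleave e f"
  let ?D = "gram_matrix (dual_form B ?M) (2 * g) (dual_basis smul (2 * g) ?b)"
  have g: "g \<ge> 1" and iso: "isocrystal smul act"
    and dm: "dieudonne_module smul act (2 * g) ?M" and qp: "quasi_polarised smul act B ?M"
    using assms(1) unfolding pftq_def by auto
  have nf: "witt_basis smul (2 * g) ?b ?M"
    "odd g \<Longrightarrow> ?D = diag_block_mat (replicate g (odd_block (?p ^ ((g - 1) div 2))))"
    "even g \<Longrightarrow> ?D = diag_block_mat (replicate (g div 2)
      (even_block (?p ^ (g div 2)) (?p ^ (g div 2 - 1))))"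
    using assms(2) unfolding normal_form_basis_def Let_def by auto
  interpret polarised_lattice smul B "2 * g" ?b ?M
    using iso dm qp nf(1)
    by (intro polarised_lattice.intro)
      (simp_all add: isocrystal_def dieudonne_module_def quasi_polarised_def)
  note p = CHAR_witt_fract_nonzero[where 'k = 'k]
  show ?thesis
  proof (intro conjI impI)
    assume odd: "odd g"
    have "G = diag_block_mat (replicate g (odd_block (inverse (?p ^ ((g - 1) div 2)))))"
      using G_carrier gram_matrix_mult_dual p unfolding nf(2)[OF odd]
      by (intro eq_diag_block_replicate_inverse_transpose[OF _ odd_block_carrier odd_block_carrier
            odd_block_inverse_transpose]) (simp_all add: mult.commute)
    then show "gram_matrix B (2 * g) ?b =
        diag_block_mat (replicate g (odd_block (?p powi (- int ((g - 1) div 2)))))"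
      by (simp add: G_def power_int_minus)
  next
    assume even: "even g"
    have "G = diag_block_mat (replicate (g div 2)
        (even_block (inverse (?p ^ (g div 2))) (inverse (?p ^ (g div 2 - 1)))))"
      using G_carrier gram_matrix_mult_dual p even unfolding nf(3)[OF even]
      by (intro eq_diag_block_replicate_inverse_transpose[OF _ even_block_carrier even_block_carrier
            even_block_inverse_transpose]) (auto elim!: evenE)
    \<comment> \<open>The truncated difference is exact because an even \<open>g \<ge> 1\<close> is at least 2.\<close>
    moreover have "- int (g div 2) + 1 = - int (g div 2 - 1)" using g even by auto
    then have "?p powi (- int (g div 2) + 1) = inverse (?p ^ (g div 2 - 1))"
      by (simp only: power_int_minus power_int_of_nat)
    ultimately show "gram_matrix B (2 * g) ?b = diag_block_mat (replicate (g div 2)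
        (even_block (?p powi (- int (g div 2))) (?p powi (- int (g div 2) + 1))))"
      by (simp add: G_def power_int_minus)
  qed
qed

end
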